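(* Let $f:\mathbb{E}\to\mathbb{R}$ be $\mu$-strongly convex with $L$-Lipschitz gradient and $L_2$-Lipschitz Hessian, $L_2\ge0$ (see context), with minimizer $x_*$ and $f_*=f(x_* )$. Let $\kappa:=L/\mu$, $H:=\sqrt2\,L_2/\mu^{3/2}$, $n:=\dim\mathbb{E}$. Let $\eta_1\in(0,\tfrac12)$ and let $(x_k)_{k\ge0}$ be generated by the BFGS method (see context) from $x_0\in\mathbb{E}$ and $H_0=(\mu_0B)^{-1}$, where $\mu_0\in[\mu,\nu\mu]$ and $\nu\in[1,\kappa]$, with the backtracking line search $h_k=2^{-i_k}$, where $i_k$ is the smallest integer $i\ge0$ such that $f(x_k)-f(x_k-2^{-i}d_k)\ge\eta_12^{-i}\langle\nabla f(x_k),d_k\rangle$. Denote $\sigma_k:=\sqrt{f(x_k)-f_*}$, $F_0:=f(x_0)-f_*$, $\Delta:=0.06(1-2\eta_1)$, $r_k:=\langle\nabla^2f(x_* )(x_k-x_* ),x_k-x_*\rangle^{1/2}$. Assume $S$ is such that $H\sum_{i=0}^{k-1}\sigma_i\le S$ for all $k\ge1$, and let $\Omega:=\psi(\nabla^2f(x_* ),\mu_0B)+2S$. Let $\bar t:=0.9\,\frac{1-2\eta_1}{2(1-\eta_1)}$, $\Upsilon:=[\omega_*(\bar t)]^{-1}$, and $$K_0^L:=\Bigl\lceil2\eta_1^{-1}\kappa^2\ln\bigl([0.06(1-2\eta_1)]^{-2}H^2F_0\bigr)+2n\ln\kappa\Bigr\rceil,\qquad K_1^L:=\bigl\lceil7(\Upsilon+3.02)\Omega\bigr\rceil,$$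 $$K_1^L(\epsilon):=\frac12\log_2\frac{(1+\frac13\Delta)^2\Delta^2}{H^2\epsilon}.$$ Then, in order to make $f(x_k)-f_*\le\epsilon$ (where $\epsilon>0$), it suffices to make the following number of iterations: $$K_0^L+K_1^L+K_1^L(\epsilon)\le\Bigl\lceil2\eta_1^{-1}\kappa^2\ln\frac{H^2F_0}{[0.06(1-2\eta_1)]^2}+2n\ln\kappa\Bigr\rceil+\bigl\lceil7(\Upsilon+3.02)\Omega\bigr\rceil+\Bigl\lceil\frac12\log_2\frac{0.01}{H^2\epsilon}\Bigr\rceil.$$ The first term is the number of iterations to reach the region of local convergence ($H\sigma_k\le\Delta$), the second one is the number of iterations to begin superlinear convergence (after which $r_{K_0^L+k}\le2^{-k}r_{K_0^L}$ for all $k\ge K_1^L$), and the third one is the number of iterations to obtain an $\epsilon$-approximate solution at a superlinear rate.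
   Context: $\mathbb{E}$ is a finite-dimensional real vector space of dimension $n$, $\mathbb{E}^*$ its dual, $\langle s,x\rangle$ the value of $s\in\mathbb{E}^*$ at $x\in\mathbb{E}$. $B:\mathbb{E}\to\mathbb{E}^*$ is a fixed self-adjoint positive definite operator; $\|u\|=\langle Bu,u\rangle^{1/2}$, $\|s\|_*=\langle s,B^{-1}s\rangle^{1/2}$; operators $\mathbb{E}\to\mathbb{E}^*$ carry the induced operator norm. With $\mu,L>0$, $L_2\ge0$, the assumptions on $f$ are, for all $x,y\in\mathbb{E}$: $\langle\nabla f(x)-\nabla f(y),x-y\rangle\ge\mu\|x-y\|^2$, $\|\nabla f(x)-\nabla f(y)\|_*\le L\|x-y\|$, $\|\nabla^2f(x)-\nabla^2f(y)\|\le L_2\|x-y\|$. For self-adjoint positive definite $X,Y:\mathbb{E}\to\mathbb{E}^*$, $\psi(X,Y):=\operatorname{Tr}(X^{-1}(Y-X))-\ln\det(X^{-1}Y)\ (\ge0)$. $\omega_*(\tau)=-\tau-\ln(1-\tau)$ for $\tau\in[0,1)$. BFGS method: given $x_0$ and self-adjoint positive definite $H_0:\mathbb{E}^*\to\mathbb{E}$, for $k\ge0$: $d_k=H_k\nabla f(x_k)$; choose a step size $h_k>0$; $x_{k+1}=x_k-h_kd_k$; $\delta_k=x_{k+1}-x_k$, $\gamma_k=\nabla f(x_{k+1})-\nabla f(x_k)$; $$H_{k+1}=H_k-\frac{H_k\gamma_k\delta_k^*+\delta_k\gamma_k^*H_k}{\langle\gamma_k,\delta_k\rangle}+\Bigl(\frac{\langle\gamma_k,H_k\gamma_k\rangle}{\langle\gamma_k,\delta_k\rangle}+1\Bigr)\frac{\delta_k\delta_k^*}{\langle\gamma_k,\delta_k\rangle},$$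 where, e.g., $(\delta\delta^* )s=\langle s,\delta\rangle\delta$ and $(H\gamma\delta^* )s=\langle s,\delta\rangle H\gamma$. Standing assumption: $\langle\gamma_k,\delta_k\rangle>0$ for all $k\ge0$ (otherwise the method has already found the minimizer). All $H_k$ are then positive definite. (The scalar constant $H$ is unrelated to the operators $H_k$.)
   Formalization: A negative ceiling in K_0^L (and in the first term of the bound) is read as 0 iterations. For L_2=0, where the formulas contain ln 0 and division by 0, K_0^L is taken as 0 and the epsilon claim and displayed bound are asserted only for L_2>0. *)

theory Defs
  imports "HOL-Analysis.Analysis"
begin

(* The space E is a type of class euclidean_space; its norm and inner product carry no
   meaning for the problem, the geometry comes from B only. *)
type_synonym 'a dual = "'a \<Rightarrow>\<^sub>L real"

definition self_adjoint :: "('a::euclidean_space \<Rightarrow>\<^sub>L 'a dual) \<Rightarrow> bool" where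
  "self_adjoint X \<longleftrightarrow> (\<forall>u v. X u v = X v u)"

definition pos_def :: "('a::euclidean_space \<Rightarrow>\<^sub>L 'a dual) \<Rightarrow> bool" where
  "pos_def X \<longleftrightarrow> (\<forall>u. u \<noteq> 0 \<longrightarrow> X u u > 0)"

definition pnorm :: "('a::euclidean_space \<Rightarrow>\<^sub>L 'a dual) \<Rightarrow> 'a \<Rightarrow> real" where
  "pnorm B u = sqrt (B u u)"

definition dual_norm :: "('a::euclidean_space \<Rightarrow>\<^sub>L 'a dual) \<Rightarrow> 'a dual \<Rightarrow> real" where
  "dual_norm B s = sqrt (s (inv (blinfun_apply B) s))"

definition op_norm :: "('a::euclidean_space \<Rightarrow>\<^sub>L 'a dual) \<Rightarrow> ('a \<Rightarrow>\<^sub>L 'a dual) \<Rightarrow> real" where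
  "op_norm B X = (SUP u\<in>{u. pnorm B u \<le> 1}. dual_norm B (X u))"

(* Trace and determinant of an endomorphism are those of its matrix in the standard basis
   (they do not depend on the basis), the basis serving as the index type. *)
typedef (overloaded) ('a::euclidean_space) basis_index = "Basis :: 'a set"
  using nonempty_Basis by blast

instance basis_index :: (euclidean_space) finite
proof
  have "(UNIV :: 'a basis_index set) = Abs_basis_index ` Basis"
    by (metis Abs_basis_index_cases UNIV_eq_I image_eqI)
  then show "finite (UNIV :: 'a basis_index set)"
    by (metis finite_Basis finite_imageI)
qed

definition endo_matrix ::
    "('a::euclidean_space \<Rightarrow> 'a) \<Rightarrow> real ^ 'a basis_index ^ 'a basis_index" where
  "endo_matrix T = (\<chi> i j. T (Rep_basis_index j) \<bullet> Rep_basis_index i)"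

definition psi :: "('a::euclidean_space \<Rightarrow>\<^sub>L 'a dual) \<Rightarrow> ('a \<Rightarrow>\<^sub>L 'a dual) \<Rightarrow> real" where
  "psi X Y = trace (endo_matrix (inv (blinfun_apply X) \<circ> blinfun_apply (Y - X)))
           - ln (det (endo_matrix (inv (blinfun_apply X) \<circ> blinfun_apply Y)))"

definition omega_star :: "real \<Rightarrow> real" where
  "omega_star \<tau> = - \<tau> - ln (1 - \<tau>)"

definition bfgs_update ::
    "('a::euclidean_space dual \<Rightarrow> 'a) \<Rightarrow> 'a \<Rightarrow> 'a dual \<Rightarrow> ('a dual \<Rightarrow> 'a)" where
  "bfgs_update H \<delta> \<gamma> = (\<lambda>s. H s
      - (s \<delta> *\<^sub>R H \<gamma> + \<gamma> (H s) *\<^sub>R \<delta>) /\<^sub>R \<gamma> \<delta>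
      + (\<gamma> (H \<gamma>) / \<gamma> \<delta> + 1) *\<^sub>R (s \<delta> *\<^sub>R \<delta>) /\<^sub>R \<gamma> \<delta>)"

definition bfgs_iterates ::
    "('a::euclidean_space \<Rightarrow> 'a dual) \<Rightarrow> (nat \<Rightarrow> real) \<Rightarrow> (nat \<Rightarrow> 'a)
      \<Rightarrow> (nat \<Rightarrow> 'a dual \<Rightarrow> 'a) \<Rightarrow> bool" where
  "bfgs_iterates grad h x H \<longleftrightarrow> (\<forall>k. h k > 0
     \<and> x (Suc k) = x k - h k *\<^sub>R H k (grad (x k))
     \<and> H (Suc k) = bfgs_update (H k) (x (Suc k) - x k) (grad (x (Suc k)) - grad (x k)))"

definition armijo ::
    "('a::euclidean_space \<Rightarrow> real) \<Rightarrow> ('a \<Rightarrow> 'a dual) \<Rightarrow> real \<Rightarrow> 'a \<Rightarrow> 'a \<Rightarrow> nat \<Rightarrow> bool" where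
  "armijo f grad \<eta> x d i \<longleftrightarrow>
     f x - f (x - (1/2)^i *\<^sub>R d) \<ge> \<eta> * (1/2)^i * grad x d"

definition backtracking ::
    "('a::euclidean_space \<Rightarrow> real) \<Rightarrow> ('a \<Rightarrow> 'a dual) \<Rightarrow> real \<Rightarrow> 'a \<Rightarrow> 'a \<Rightarrow> real \<Rightarrow> bool" where
  "backtracking f grad \<eta> x d h \<longleftrightarrow>
     (\<exists>i. h = (1/2)^i \<and> armijo f grad \<eta> x d i \<and> (\<forall>j<i. \<not> armijo f grad \<eta> x d j))"

end

(*
  The operators G_k = H_k^{-1} follow the dual BFGS update, and psi(X, G_k) - psi(X, G_{k+1}) has a
  closed form for every positive definite X.  With X = L B this difference is at least some p_k for
  which the line search guarantees F_{k+1} <= (1 - eta_1 kappa^{-2} exp(-p_k)) F_k, where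
  F_k = f(x_k) - f_*; since psi >= 0, the p_k sum up to at most n ln kappa, which gives global linear
  convergence.  With X the Hessian at x_*, the difference is at least q_k - 2 H sigma_k, where q_k
  measures the distance of the BFGS direction from the Newton direction: when q_k < omega_*(tbar) the
  unit step is accepted and r_{k+1} <= (0.06 + 1.06 theta_k) r_k with theta_k^2 <= 8 q_k, otherwise
  r_{k+1} <= 1.02 r_k.  Hence r_{k+1} <= exp(-1 + M q_k) r_k always, and the q_k sum up to at most
  Omega.
*)

theory Submission
  imports Defs
begin

subsection \<open>Positive definite operators\<close>

text \<open>Integrals of operators and eigenvalues are avoided. The mean Hessian along a step is
  seen only through scalar mean value theorems whose test vector is fixed in advance, and
  \<open>psi \<ge> 0\<close> is derived from the BFGS update itself. Two reserves explain the
  constants. Up to the factor \<open>exp (M * q k)\<close> a step shrinks \<open>r\<close> by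
  \<open>exp (- 1)\<close>, while only the factor 1/2 is claimed; so each iteration saves
  \<open>1 - ln 2\<close>, at least 11/36, out of which \<open>M * \<Omega>\<close> is paid. The 0.9
  in \<open>tbar\<close> leaves a tenth of \<open>1 - 2 * \<eta>\<close> for the variation of the
  Hessian along the trial step. The linear phase covers this case: its rate
  \<open>\<eta> / \<kappa>^2\<close> is at most 1, hence below \<open>ln 4\<close>, so
  \<open>m\<close> iterations before the region the gap is at most \<open>4^m\<close> times that of
  the region. This is exactly the price at which the third count trades iterations for
  accuracy.\<close>

definition spd :: "('a::euclidean_space \<Rightarrow>\<^sub>L 'a dual) \<Rightarrow> bool" where
  "spd X \<longleftrightarrow> self_adjoint X \<and> pos_def X"

lemma spd_sym: "spd X \<Longrightarrow> X u v = X v u"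
  by (auto simp: spd_def self_adjoint_def)

lemma spd_pos: "spd X \<Longrightarrow> u \<noteq> 0 \<Longrightarrow> X u u > 0"
  by (auto simp: spd_def pos_def_def)

lemma spd_nonneg: "spd X \<Longrightarrow> X u u \<ge> 0"
  by (cases "u = 0") (auto dest: spd_pos less_imp_le)

lemma spd_scaleR: "spd X \<Longrightarrow> c > 0 \<Longrightarrow> spd (c *\<^sub>R X)"
  by (auto simp: spd_def self_adjoint_def pos_def_def blinfun.scaleR_left)

lemma spd_bij:
  fixes X :: "'a::euclidean_space \<Rightarrow>\<^sub>L 'a dual"
  assumes "spd X"
  shows "bij (blinfun_apply X)"
proof -
  have inj0: "X v = 0 \<Longrightarrow> v = 0" for v
    using spd_pos[OF assms, of v] by force
  \<comment> \<open>The Riesz representative of \<open>X v\<close> turns \<open>X\<close> into an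
    endomorphism, for which injectivity gives surjectivity.\<close>
  define T where "T v = (\<Sum>b\<in>Basis. X v b *\<^sub>R b)" for v :: 'a
  have lin: "linear T"
    by (rule linearI)
      (auto simp: T_def blinfun.add_right blinfun.add_left blinfun.scaleR_left blinfun.scaleR_right
         scaleR_add_left sum.distrib scaleR_sum_right)
  have Tb: "T v \<bullet> b = X v b" if "b \<in> Basis" for v b
    using that by (simp add: T_def inner_sum_left inner_Basis if_distrib sum.If_cases cong: if_cong)
  have eqI: "s = t" if "\<And>b. b \<in> Basis \<Longrightarrow> s b = t b" for s t :: "'a dual"
    using that by (rule blinfun_euclidean_eqI)
  have "inj T"
  proof (subst linear_injective_0[OF lin], safe)
    fix v assume "T v = 0"
    then have "X v b = 0" if "b \<in> Basis" for b using Tb[OF that, of v] by simp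
    then have "X v = 0" by (intro eqI) simp
    then show "v = 0" by (rule inj0)
  qed
  then have "surj T" using lin linear_injective_imp_surjective by blast
  have "\<exists>v. s = X v" for s
  proof -
    obtain v where v: "T v = (\<Sum>b\<in>Basis. s b *\<^sub>R b)"
      using \<open>surj T\<close> by (metis surjD)
    have "s b = X v b" if "b \<in> Basis" for b
    proof -
      have "X v b = (\<Sum>b\<in>Basis. s b *\<^sub>R b) \<bullet> b" using v Tb[OF that, of v] by simp
      also have "\<dots> = s b"
        using that by (simp add: inner_sum_left inner_Basis if_distrib sum.If_cases cong: if_cong)
      finally show ?thesis by simp
    qed
    then show ?thesis using eqI by blast
  qed
  moreover have "inj (blinfun_apply X)"
    by (rule injI) (metis blinfun.diff_right inj0 right_minus_eq)
  ultimately show ?thesis by (auto simp: bij_def surj_def)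
qed

lemma spd_inv_right: "spd X \<Longrightarrow> X (inv (blinfun_apply X) s) = s"
  by (simp add: spd_bij bij_is_surj surj_f_inv_f)

lemma spd_inv_left: "spd X \<Longrightarrow> inv (blinfun_apply X) (X v) = v"
  by (simp add: spd_bij bij_is_inj)

lemma spd_inv_eqI: "spd X \<Longrightarrow> X v = s \<Longrightarrow> inv (blinfun_apply X) s = v"
  using spd_inv_left by blast

lemma linear_spd_inv:
  assumes "spd X" shows "linear (inv (blinfun_apply X))"
proof (rule linearI)
  fix s t show "inv (blinfun_apply X) (s + t) = inv (blinfun_apply X) s + inv (blinfun_apply X) t"
    by (rule spd_inv_eqI[OF assms]) (simp add: blinfun.add_right spd_inv_right[OF assms])
next
  fix c s show "inv (blinfun_apply X) (c *\<^sub>R s) = c *\<^sub>R inv (blinfun_apply X) s"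
    by (rule spd_inv_eqI[OF assms]) (simp add: blinfun.scaleR_right spd_inv_right[OF assms])
qed

lemma spd_inv_sym:
  fixes X :: "'a::euclidean_space \<Rightarrow>\<^sub>L 'a dual" and s t :: "'a dual"
  assumes "spd X"
  shows "s (inv (blinfun_apply X) t) = t (inv (blinfun_apply X) s)"
  using spd_sym[OF assms, of "inv (blinfun_apply X) s" "inv (blinfun_apply X) t"]
  by (simp add: spd_inv_right[OF assms])

lemma spd_inv_nonneg:
  fixes X :: "'a::euclidean_space \<Rightarrow>\<^sub>L 'a dual" and s :: "'a dual"
  assumes "spd X" shows "s (inv (blinfun_apply X) s) \<ge> 0"
  using spd_nonneg[OF assms, of "inv (blinfun_apply X) s"] by (simp add: spd_inv_right[OF assms])

lemma spd_inv_pos: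
  fixes X :: "'a::euclidean_space \<Rightarrow>\<^sub>L 'a dual" and s :: "'a dual"
  assumes "spd X" "s \<noteq> 0" shows "s (inv (blinfun_apply X) s) > 0"
proof -
  have "inv (blinfun_apply X) s \<noteq> 0"
    using spd_inv_right[OF assms(1), of s] assms(2) by auto
  from spd_pos[OF assms(1) this] show ?thesis by (simp add: spd_inv_right[OF assms(1)])
qed

lemma spd_Cauchy_Schwarz:
  assumes X: "spd X"
  shows "(X u v)\<^sup>2 \<le> X u u * X v v"
proof (cases "v = 0")
  case False
  have p: "X v v > 0" using spd_pos[OF X False] .
  define t where "t = X u v / X v v"
  have "0 \<le> X (u - t *\<^sub>R v) (u - t *\<^sub>R v)" by (rule spd_nonneg[OF X])
  also have "\<dots> = X u u - 2 * t * X u v + t\<^sup>2 * X v v"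
    using spd_sym[OF X, of v u]
    by (simp add: blinfun.diff_right blinfun.diff_left blinfun.scaleR_left blinfun.scaleR_right
        power2_eq_square algebra_simps)
  also have "\<dots> = X u u - (X u v)\<^sup>2 / X v v"
    using p by (simp add: t_def power2_eq_square field_simps)
  finally show ?thesis using p by (simp add: field_simps)
qed auto

lemma spd_dual_Cauchy_Schwarz:
  fixes X :: "'a::euclidean_space \<Rightarrow>\<^sub>L 'a dual" and s :: "'a dual"
  assumes X: "spd X"
  shows "(s v)\<^sup>2 \<le> s (inv (blinfun_apply X) s) * X v v"
  using spd_Cauchy_Schwarz[OF X, of "inv (blinfun_apply X) s" v] by (simp add: spd_inv_right[OF X])

section \<open>Primal, dual and operator norms induced by a positive definite operator\<close>

lemma pnorm_nonneg: "spd B \<Longrightarrow> pnorm B u \<ge> 0"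
  by (simp add: pnorm_def spd_nonneg)

lemma pnorm_square: "spd B \<Longrightarrow> (pnorm B u)\<^sup>2 = B u u"
  by (simp add: pnorm_def spd_nonneg)

lemma pnorm_zero [simp]: "pnorm B 0 = 0"
  by (simp add: pnorm_def)

lemma pnorm_scaleR: "spd B \<Longrightarrow> pnorm B (c *\<^sub>R u) = \<bar>c\<bar> * pnorm B u"
  by (simp add: pnorm_def blinfun.scaleR_left blinfun.scaleR_right real_sqrt_mult
      flip: mult.assoc power2_eq_square)

lemma pnorm_minus: "pnorm B (- u) = pnorm B u"
  by (simp add: pnorm_def blinfun.minus_left blinfun.minus_right)

lemma pnorm_pos: "spd B \<Longrightarrow> u \<noteq> 0 \<Longrightarrow> pnorm B u > 0"
  by (simp add: pnorm_def spd_pos)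

lemma spd_le_pnorm:
  assumes "spd B" shows "B u v \<le> pnorm B u * pnorm B v"
  using spd_Cauchy_Schwarz[OF assms, of u v] unfolding pnorm_def
  by (metis real_sqrt_mult real_le_rsqrt)

lemma pnorm_triangle:
  assumes B: "spd B" shows "pnorm B (u + v) \<le> pnorm B u + pnorm B v"
proof (rule power2_le_imp_le)
  have "(pnorm B (u + v))\<^sup>2 = B u u + 2 * B u v + B v v"
    using spd_sym[OF B, of v u] by (simp add: pnorm_square[OF B] blinfun.add_left blinfun.add_right)
  also have "\<dots> \<le> (pnorm B u + pnorm B v)\<^sup>2"
    using spd_le_pnorm[OF B, of u v] by (simp add: power2_sum pnorm_square[OF B])
  finally show "(pnorm B (u + v))\<^sup>2 \<le> (pnorm B u + pnorm B v)\<^sup>2" .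
qed (simp add: pnorm_nonneg[OF B])

lemma dual_norm_nonneg: "spd B \<Longrightarrow> dual_norm B s \<ge> 0"
  by (simp add: dual_norm_def spd_inv_nonneg)

lemma dual_norm_square:
  fixes B :: "'a::euclidean_space \<Rightarrow>\<^sub>L 'a dual" and s :: "'a dual"
  shows "spd B \<Longrightarrow> (dual_norm B s)\<^sup>2 = s (inv (blinfun_apply B) s)"
  by (simp add: dual_norm_def spd_inv_nonneg)

lemma dual_norm_eq_pnorm:
  fixes B :: "'a::euclidean_space \<Rightarrow>\<^sub>L 'a dual" and s :: "'a dual"
  assumes B: "spd B" shows "dual_norm B s = pnorm B (inv (blinfun_apply B) s)"
  by (simp add: dual_norm_def pnorm_def spd_inv_right[OF B])

lemma dual_norm_apply: "spd B \<Longrightarrow> dual_norm B (B v) = pnorm B v"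
  by (simp add: dual_norm_eq_pnorm spd_inv_left)

lemma dual_norm_triangle:
  assumes B: "spd B" shows "dual_norm B (s + t) \<le> dual_norm B s + dual_norm B t"
  using pnorm_triangle[OF B] by (simp add: dual_norm_eq_pnorm[OF B] linear_add[OF linear_spd_inv[OF B]])

lemma dual_norm_scaleR:
  assumes B: "spd B" shows "dual_norm B (c *\<^sub>R s) = \<bar>c\<bar> * dual_norm B s"
  by (simp add: dual_norm_eq_pnorm[OF B] linear_scale[OF linear_spd_inv[OF B]] pnorm_scaleR[OF B])

lemma dual_norm_leI:
  fixes B :: "'a::euclidean_space \<Rightarrow>\<^sub>L 'a dual" and s :: "'a dual"
  assumes B: "spd B" and "c \<ge> 0" and le: "\<And>v. s v \<le> c * pnorm B v"
  shows "dual_norm B s \<le> c"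
proof -
  have "dual_norm B s * dual_norm B s \<le> c * dual_norm B s"
    using le[of "inv (blinfun_apply B) s"] dual_norm_square[OF B, of s]
    by (simp add: dual_norm_eq_pnorm[OF B] power2_eq_square)
  then show ?thesis
    using dual_norm_nonneg[OF B, of s] \<open>c \<ge> 0\<close>
    by (metis dual_order.order_iff_strict mult_le_cancel_right not_le)
qed

lemma abs_le_dual_norm:
  fixes B :: "'a::euclidean_space \<Rightarrow>\<^sub>L 'a dual" and s :: "'a dual"
  assumes B: "spd B" shows "\<bar>s v\<bar> \<le> dual_norm B s * pnorm B v"
  using spd_dual_Cauchy_Schwarz[OF B, of s v] unfolding pnorm_def dual_norm_def
  by (metis real_sqrt_mult real_sqrt_abs real_sqrt_le_mono)

text \<open>Compactness of the unit sphere. It serves to show that the set under the supremum in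
  \<open>op_norm\<close> is bounded above, without which that supremum could not be compared with
  its members.\<close>

lemma spd_coercive:
  fixes B :: "'a::euclidean_space \<Rightarrow>\<^sub>L 'a dual"
  assumes B: "spd B"
  obtains m where "m > 0" "\<And>u. m * norm u \<le> pnorm B u"
proof -
  have c: "continuous_on (sphere 0 1) (\<lambda>u. B u u)"
    by (intro continuous_intros)
  have ne: "sphere (0::'a) 1 \<noteq> {}" by simp
  obtain w where w: "w \<in> sphere 0 1" and wmin: "\<And>u. u \<in> sphere 0 1 \<Longrightarrow> B w w \<le> B u u"
    using continuous_attains_inf[OF compact_sphere ne c] by blast
  have "w \<noteq> 0" using w by auto
  show ?thesis
  proof
    show "pnorm B w > 0" using pnorm_pos[OF B \<open>w \<noteq> 0\<close>] .
    fix u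
    show "pnorm B w * norm u \<le> pnorm B u"
    proof (cases "u = 0")
      case False
      define e where "e = u /\<^sub>R norm u"
      have e: "e \<in> sphere 0 1" and u: "u = norm u *\<^sub>R e" using False by (auto simp: e_def)
      have "pnorm B w \<le> pnorm B e" using wmin[OF e] by (simp add: pnorm_def)
      moreover have "pnorm B u = norm u * pnorm B e" by (subst u) (simp add: pnorm_scaleR[OF B])
      ultimately show ?thesis by (simp add: mult.commute mult_left_mono)
    qed simp
  qed
qed

lemma dual_norm_le_op_norm:
  fixes B X :: "'a::euclidean_space \<Rightarrow>\<^sub>L 'a dual"
  assumes B: "spd B"
  shows "dual_norm B (X u) \<le> op_norm B X * pnorm B u"
proof (cases "u = 0")
  case True
  then show ?thesis by (simp add: dual_norm_def)
next
  case False
  obtain m where m: "m > 0" "\<And>u. m * norm u \<le> pnorm B u" using spd_coercive[OF B] by blast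
  have "dual_norm B (X v) \<le> norm X / m / m" if "pnorm B v \<le> 1" for v
  proof (rule dual_norm_leI[OF B])
    fix w
    have nv: "norm v \<le> 1 / m" and nw: "norm w \<le> pnorm B w / m"
      using m(2)[of v] m(2)[of w] that m(1) by (auto simp: field_simps)
    have "X v w \<le> norm (X v) * norm w" using norm_blinfun[of "X v" w] by auto
    also have "\<dots> \<le> (norm X * norm v) * norm w" by (intro mult_right_mono norm_blinfun) auto
    also have "\<dots> \<le> (norm X * (1 / m)) * (pnorm B w / m)"
      using nv nw m(1) by (intro mult_mono) auto
    finally show "X v w \<le> norm X / m / m * pnorm B w" by simp
  qed (use m in auto)
  then have bdd: "bdd_above ((\<lambda>u. dual_norm B (X u)) ` {u. pnorm B u \<le> 1})"
    by (intro bdd_aboveI[of _ "norm X / m / m"]) auto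
  have p: "pnorm B u > 0" using pnorm_pos[OF B False] .
  define e where "e = u /\<^sub>R pnorm B u"
  have u: "u = pnorm B u *\<^sub>R e" and e: "pnorm B e \<le> 1"
    using p by (auto simp: e_def pnorm_scaleR[OF B])
  have "dual_norm B (X e) \<le> op_norm B X"
    unfolding op_norm_def using e by (intro cSUP_upper[OF _ bdd]) simp
  moreover have "dual_norm B (X u) = pnorm B u * dual_norm B (X e)"
    by (subst u) (simp add: blinfun.scaleR_right dual_norm_scaleR[OF B] pnorm_nonneg[OF B])
  ultimately show ?thesis using p by (simp add: mult.commute mult_left_mono)
qed

lemma abs_le_op_norm:
  fixes B X :: "'a::euclidean_space \<Rightarrow>\<^sub>L 'a dual"
  assumes B: "spd B"
  shows "\<bar>X u v\<bar> \<le> op_norm B X * pnorm B u * pnorm B v"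
  using abs_le_dual_norm[OF B, of "X u" v] dual_norm_le_op_norm[OF B, of X u] pnorm_nonneg[OF B, of v]
  by (meson mult_right_mono order_trans)

subsection \<open>Strongly convex functions with Lipschitz Hessian\<close>

text \<open>Taylor's formula with the weight \<open>1 - t\<close> on the second derivative: an
  affine minorant contributes \<alpha>/2 + \<beta>/6. Two monotonicity arguments replace the
  integral.\<close>

lemma second_order_lower_bound:
  fixes \<phi> p q :: "real \<Rightarrow> real"
  assumes \<phi>: "\<And>t. (\<phi> has_real_derivative p t) (at t)"
    and p: "\<And>t. (p has_real_derivative q t) (at t)"
    and q: "\<And>t. 0 \<le> t \<Longrightarrow> t \<le> 1 \<Longrightarrow> \<alpha> + \<beta> * t \<le> q t"
  shows "\<phi> 0 + p 0 + \<alpha> / 2 + \<beta> / 6 \<le> \<phi> 1"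
proof -
  have p_ge: "p 0 + \<alpha> * t + \<beta> * t\<^sup>2 / 2 \<le> p t" if t: "0 \<le> t" "t \<le> 1" for t
  proof -
    have "\<exists>y. ((\<lambda>t. p t - \<alpha> * t - \<beta> * t\<^sup>2 / 2) has_real_derivative y) (at s) \<and> 0 \<le> y"
      if "0 \<le> s" "s \<le> t" for s
      using q[of s] that t
      by (intro exI[of _ "q s - \<alpha> - \<beta> * s"] conjI) (auto intro!: derivative_eq_intros p)
    from DERIV_nonneg_imp_nondecreasing[OF t(1) this] show ?thesis by simp
  qed
  have "\<exists>y. ((\<lambda>t. \<phi> t - p 0 * t - \<alpha> * t\<^sup>2 / 2 - \<beta> * t ^ 3 / 6) has_real_derivative y) (at s) \<and> 0 \<le> y"
    if "0 \<le> s" "s \<le> 1" for s :: real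
    using p_ge[of s] that
    by (intro exI[of _ "p s - p 0 - \<alpha> * s - \<beta> * s\<^sup>2 / 2"] conjI)
       (auto intro!: derivative_eq_intros \<phi> simp: power2_eq_square)
  from DERIV_nonneg_imp_nondecreasing[OF zero_le_one this] show ?thesis by simp
qed

lemma second_order_upper_bound:
  fixes \<phi> p q :: "real \<Rightarrow> real"
  assumes \<phi>: "\<And>t. (\<phi> has_real_derivative p t) (at t)"
    and p: "\<And>t. (p has_real_derivative q t) (at t)"
    and q: "\<And>t. 0 \<le> t \<Longrightarrow> t \<le> 1 \<Longrightarrow> q t \<le> \<alpha> + \<beta> * t"
  shows "\<phi> 1 \<le> \<phi> 0 + p 0 + \<alpha> / 2 + \<beta> / 6"
proof -
  have "- \<alpha> + - \<beta> * t \<le> - q t" if "0 \<le> t" "t \<le> 1" for t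
    using q[OF that] by simp
  from second_order_lower_bound[OF DERIV_minus[OF \<phi>] DERIV_minus[OF p] this] show ?thesis by simp
qed

locale strongly_convex_smooth =
  fixes B :: "'a::euclidean_space \<Rightarrow>\<^sub>L 'a dual"
    and f :: "'a \<Rightarrow> real"
    and grad :: "'a \<Rightarrow> 'a dual"
    and hess :: "'a \<Rightarrow> ('a \<Rightarrow>\<^sub>L 'a dual)"
    and \<mu> L L2 :: real
    and xstar :: 'a
  assumes spd_B: "spd B"
    and mu_pos: "\<mu> > 0" and L_pos: "L > 0" and L2_nonneg: "L2 \<ge> 0"
    and grad: "\<And>u. (f has_derivative grad u) (at u)"
    and hess: "\<And>u. (grad has_derivative hess u) (at u)"
    and strongly_monotone: "\<And>u v. (grad u - grad v) (u - v) \<ge> \<mu> * (pnorm B (u - v))\<^sup>2"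
    and grad_Lipschitz: "\<And>u v. dual_norm B (grad u - grad v) \<le> L * pnorm B (u - v)"
    and hess_Lipschitz: "\<And>u v. op_norm B (hess u - hess v) \<le> L2 * pnorm B (u - v)"
    and minimizer: "\<And>u. f xstar \<le> f u"
begin

lemma DERIV_f_line: "((\<lambda>t. f (x + t *\<^sub>R v)) has_real_derivative grad (x + t *\<^sub>R v) v) (at t)"
proof -
  have "((\<lambda>t. f (x + t *\<^sub>R v)) has_derivative (\<lambda>s. grad (x + t *\<^sub>R v) (s *\<^sub>R v))) (at t)"
    by (rule has_derivative_compose[OF _ grad]) (auto intro!: derivative_eq_intros)
  then show ?thesis
    unfolding has_field_derivative_def
    by (rule has_derivative_eq_rhs) (auto simp: fun_eq_iff blinfun.scaleR_right)
qed

lemma DERIV_grad_line: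
  "((\<lambda>t. grad (x + t *\<^sub>R v) w) has_real_derivative hess (x + t *\<^sub>R v) v w) (at t)"
proof -
  have "((\<lambda>t. grad (x + t *\<^sub>R v)) has_derivative (\<lambda>s. hess (x + t *\<^sub>R v) (s *\<^sub>R v))) (at t)"
    by (rule has_derivative_compose[OF _ hess]) (auto intro!: derivative_eq_intros)
  then have "((\<lambda>t. grad (x + t *\<^sub>R v) w) has_derivative (\<lambda>s. hess (x + t *\<^sub>R v) (s *\<^sub>R v) w)) (at t)"
    by (auto intro!: derivative_eq_intros)
  then show ?thesis
    unfolding has_field_derivative_def
    by (rule has_derivative_eq_rhs) (auto simp: fun_eq_iff blinfun.scaleR_right blinfun.scaleR_left)
qed

text \<open>The intermediate point depends on \<open>w\<close>, so each application has to put
  everything it wants to know into a single test vector.\<close>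

lemma grad_mean_value:
  obtains \<xi> where "0 < \<xi>" "\<xi> < 1" "(grad (x + v) - grad x) w = hess (x + \<xi> *\<^sub>R v) v w"
proof -
  obtain \<xi> where "0 < \<xi>" "\<xi> < 1"
    "grad (x + 1 *\<^sub>R v) w - grad (x + 0 *\<^sub>R v) w = (1 - 0) * hess (x + \<xi> *\<^sub>R v) v w"
    using MVT2[OF zero_less_one, of "\<lambda>t. grad (x + t *\<^sub>R v) w"  "\<lambda>\<xi>. hess (x + \<xi> *\<^sub>R v) v w"]
      DERIV_grad_line by blast
  then show ?thesis using that by (simp add: blinfun.diff_left)
qed

text \<open>Strong monotonicity and the Lipschitz bound, applied to \<open>x + t *\<^sub>R v\<close>
  and \<open>x\<close>, bound the difference quotient of the gradient; let \<open>t\<close> tend to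
  0 from the right.\<close>

lemma hess_quadratic_bounds: "\<mu> * B v v \<le> hess x v v" "hess x v v \<le> L * B v v"
proof -
  let ?p = "\<lambda>t. grad (x + t *\<^sub>R v) v"
  have "((\<lambda>t. (?p (0 + t) - ?p 0) / t) \<longlongrightarrow> hess (x + 0 *\<^sub>R v) v v) (at 0)"
    using DERIV_grad_line[of x v v 0] unfolding DERIV_def .
  then have lim: "((\<lambda>t. (?p t - ?p 0) / t) \<longlongrightarrow> hess x v v) (at_right 0)"
    by (auto intro: tendsto_within_subset)
  have ge: "\<mu> * B v v \<le> (?p t - ?p 0) / t" if "t > 0" for t
  proof -
    have "t * (\<mu> * B v v * t) \<le> t * (?p t - ?p 0)"
      using strongly_monotone[of "x + t *\<^sub>R v" x] that
      by (simp add: pnorm_square[OF spd_B] blinfun.scaleR_left blinfun.scaleR_right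
            blinfun.diff_left algebra_simps)
    then have "\<mu> * B v v * t \<le> ?p t - ?p 0" using that by (simp only: mult_le_cancel_left_pos)
    then show ?thesis using that by (simp only: pos_le_divide_eq)
  qed
  have le: "(?p t - ?p 0) / t \<le> L * B v v" if "t > 0" for t
  proof -
    have "?p t - ?p 0 \<le> dual_norm B (grad (x + t *\<^sub>R v) - grad x) * pnorm B v"
      using abs_le_dual_norm[OF spd_B, of "grad (x + t *\<^sub>R v) - grad x" v] by (simp add: blinfun.diff_left)
    also have "\<dots> \<le> L * pnorm B (t *\<^sub>R v) * pnorm B v"
      using grad_Lipschitz[of "x + t *\<^sub>R v" x] by (intro mult_right_mono) (auto simp: pnorm_nonneg[OF spd_B])
    also have "\<dots> = L * B v v * t"
      using that by (simp add: pnorm_scaleR[OF spd_B] flip: pnorm_square[OF spd_B])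
         (simp add: power2_eq_square)
    finally show ?thesis using that by (simp add: field_simps)
  qed
  show "\<mu> * B v v \<le> hess x v v"
    by (rule tendsto_lowerbound[OF lim])
      (use ge in \<open>auto simp: eventually_at_right_field intro!: exI[of _ 1]\<close>)
  show "hess x v v \<le> L * B v v"
    by (rule tendsto_upperbound[OF lim])
      (use le in \<open>auto simp: eventually_at_right_field intro!: exI[of _ 1]\<close>)
qed

lemma hess_diff_le:
  "\<bar>hess y u v - hess x u v\<bar> \<le> L2 * pnorm B (y - x) * pnorm B u * pnorm B v"
proof -
  have "\<bar>(hess y - hess x) u v\<bar> \<le> op_norm B (hess y - hess x) * pnorm B u * pnorm B v"
    by (rule abs_le_op_norm[OF spd_B])
  also have "\<dots> \<le> L2 * pnorm B (y - x) * pnorm B u * pnorm B v"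
    by (intro mult_right_mono hess_Lipschitz pnorm_nonneg[OF spd_B])
  finally show ?thesis by (simp add: blinfun.diff_left)
qed

text \<open>Towards the symmetry of the Hessian: the mixed second difference is symmetric in
  \<open>u\<close> and \<open>v\<close>, whereas its expression through the Hessian is not visibly
  so.\<close>

lemma second_difference:
  assumes "s > 0"
  obtains z where "pnorm B (z - x) \<le> s * (pnorm B u + pnorm B v)"
    "f (x + s *\<^sub>R u + s *\<^sub>R v) - f (x + s *\<^sub>R u) - f (x + s *\<^sub>R v) + f x = s\<^sup>2 * hess z v u"
proof -
  have "\<And>t. ((\<lambda>t. f (x + s *\<^sub>R v + t *\<^sub>R (s *\<^sub>R u)) - f (x + t *\<^sub>R (s *\<^sub>R u))) has_real_derivative
     (grad (x + s *\<^sub>R v + t *\<^sub>R (s *\<^sub>R u)) (s *\<^sub>R u) - grad (x + t *\<^sub>R (s *\<^sub>R u)) (s *\<^sub>R u))) (at t)"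
    by (intro derivative_intros DERIV_f_line)
  from MVT2[OF zero_less_one this] obtain t where t: "0 < t" "t < 1"
    and 1: "(f (x + s *\<^sub>R v + s *\<^sub>R u) - f (x + s *\<^sub>R u)) - (f (x + s *\<^sub>R v) - f x)
      = (grad (x + s *\<^sub>R v + t *\<^sub>R (s *\<^sub>R u)) - grad (x + t *\<^sub>R (s *\<^sub>R u))) (s *\<^sub>R u)"
    by (auto simp: blinfun.diff_left)
  obtain \<xi> where \<xi>: "0 < \<xi>" "\<xi> < 1"
    and 2: "(grad (x + t *\<^sub>R (s *\<^sub>R u) + s *\<^sub>R v) - grad (x + t *\<^sub>R (s *\<^sub>R u))) (s *\<^sub>R u)
      = hess (x + t *\<^sub>R (s *\<^sub>R u) + \<xi> *\<^sub>R (s *\<^sub>R v)) (s *\<^sub>R v) (s *\<^sub>R u)"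
    by (rule grad_mean_value)
  let ?z = "x + t *\<^sub>R (s *\<^sub>R u) + \<xi> *\<^sub>R (s *\<^sub>R v)"
  have "pnorm B (?z - x) \<le> pnorm B (t *\<^sub>R (s *\<^sub>R u)) + pnorm B (\<xi> *\<^sub>R (s *\<^sub>R v))"
    using pnorm_triangle[OF spd_B, of "t *\<^sub>R (s *\<^sub>R u)" "\<xi> *\<^sub>R (s *\<^sub>R v)"] by (simp add: algebra_simps)
  also have "\<dots> = t * (s * pnorm B u) + \<xi> * (s * pnorm B v)"
    using t \<xi> assms by (simp add: pnorm_scaleR[OF spd_B] abs_mult)
  also have "\<dots> \<le> 1 * (s * pnorm B u) + 1 * (s * pnorm B v)"
    using t \<xi> assms pnorm_nonneg[OF spd_B] by (intro add_mono mult_right_mono) auto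
  finally have "pnorm B (?z - x) \<le> s * (pnorm B u + pnorm B v)" by (simp add: algebra_simps)
  moreover have "f (x + s *\<^sub>R u + s *\<^sub>R v) - f (x + s *\<^sub>R u) - f (x + s *\<^sub>R v) + f x = s\<^sup>2 * hess ?z v u"
  proof -
    have "f (x + s *\<^sub>R u + s *\<^sub>R v) - f (x + s *\<^sub>R u) - f (x + s *\<^sub>R v) + f x
      = (f (x + s *\<^sub>R v + s *\<^sub>R u) - f (x + s *\<^sub>R u)) - (f (x + s *\<^sub>R v) - f x)"
      by (simp add: add.assoc add.commute[of "s *\<^sub>R u"])
    also have "\<dots> = (grad (x + t *\<^sub>R (s *\<^sub>R u) + s *\<^sub>R v) - grad (x + t *\<^sub>R (s *\<^sub>R u))) (s *\<^sub>R u)"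
      unfolding 1 by (simp only: add.assoc add.commute[of "s *\<^sub>R v"])
    also have "\<dots> = s\<^sup>2 * hess ?z v u"
      unfolding 2 by (simp only: blinfun.scaleR_left blinfun.scaleR_right) (simp add: power2_eq_square)
    finally show ?thesis .
  qed
  ultimately show ?thesis by (rule that)
qed

lemma hess_sym: "hess x u v = hess x v u"
proof (rule ccontr)
  assume ne: "hess x u v \<noteq> hess x v u"
  define c where "c = L2 * (pnorm B u + pnorm B v) * pnorm B u * pnorm B v"
  have c0: "c \<ge> 0" unfolding c_def by (simp add: L2_nonneg pnorm_nonneg[OF spd_B])
  have close: "\<bar>hess z a b - hess x a b\<bar> \<le> s * c"
    if "pnorm B (z - x) \<le> s * (pnorm B u + pnorm B v)" "a = u \<and> b = v \<or> a = v \<and> b = u" for z a b s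
  proof -
    have "\<bar>hess z a b - hess x a b\<bar> \<le> L2 * pnorm B (z - x) * pnorm B a * pnorm B b" by (rule hess_diff_le)
    also have "\<dots> \<le> L2 * (s * (pnorm B u + pnorm B v)) * pnorm B a * pnorm B b"
      using that(1) by (intro mult_right_mono mult_left_mono L2_nonneg pnorm_nonneg[OF spd_B])
    finally show ?thesis using that(2) by (auto simp: c_def algebra_simps)
  qed
  have bound: "\<bar>hess x u v - hess x v u\<bar> \<le> 2 * s * c" if s: "s > 0" for s
  proof -
    obtain z1 where z1: "pnorm B (z1 - x) \<le> s * (pnorm B u + pnorm B v)"
      "f (x + s *\<^sub>R u + s *\<^sub>R v) - f (x + s *\<^sub>R u) - f (x + s *\<^sub>R v) + f x = s\<^sup>2 * hess z1 v u"
      using second_difference[OF s] by blast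
    obtain z2 where z2: "pnorm B (z2 - x) \<le> s * (pnorm B v + pnorm B u)"
      "f (x + s *\<^sub>R v + s *\<^sub>R u) - f (x + s *\<^sub>R v) - f (x + s *\<^sub>R u) + f x = s\<^sup>2 * hess z2 u v"
      using second_difference[OF s] by blast
    have "s\<^sup>2 * hess z1 v u = s\<^sup>2 * hess z2 u v"
      unfolding z1(2)[symmetric] z2(2)[symmetric] by (simp add: algebra_simps)
    then have eq: "hess z1 v u = hess z2 u v" using s by simp
    show ?thesis
      using close[OF z1(1), of v u] close[of z2 s u v] z2(1) eq by (simp add: add.commute)
  qed
  \<comment> \<open>So small that the bound \<open>2 * s * c\<close> is less than half of the
    supposed asymmetry.\<close>
  define s where "s = \<bar>hess x u v - hess x v u\<bar> / (4 * (c + 1))"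
  have "s > 0" using ne c0 by (simp add: s_def)
  have "2 * s * (c + 1) = \<bar>hess x u v - hess x v u\<bar> / 2"
    using c0 by (simp add: s_def field_simps)
  moreover have "2 * s * c < 2 * s * (c + 1)" using \<open>s > 0\<close> by simp
  ultimately have "\<bar>hess x u v - hess x v u\<bar> < \<bar>hess x u v - hess x v u\<bar> / 2"
    using bound[OF \<open>s > 0\<close>] by simp
  moreover have "\<not> D < D / 2" if "D \<ge> 0" for D :: real using that by simp
  ultimately show False using abs_ge_zero by blast
qed

lemma spd_hess: "spd (hess x)"
proof -
  have "hess x u u > 0" if "u \<noteq> 0" for u
    using hess_quadratic_bounds(1)[of u x] spd_pos[OF spd_B that] mu_pos
    by (meson less_le_trans mult_pos_pos)
  then show ?thesis by (auto simp: spd_def self_adjoint_def pos_def_def hess_sym)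
qed

text \<open>The average Hessian \<open>J\<close> along the segment satisfies \<open>J \<le> C A\<close>, whence \<open>J A\<^sup>-\<^sup>1 J \<le> C J\<close>; testing
  the mean value theorem against \<open>v - (2/C) A\<^sup>-\<^sup>1 g\<close> gives this without integrating.\<close>

lemma cocoercive:
  assumes A: "spd A" and "C > 0"
    and le: "\<And>\<xi> w. 0 < \<xi> \<Longrightarrow> \<xi> < 1 \<Longrightarrow> hess (x + \<xi> *\<^sub>R v) w w \<le> C * A w w"
  shows "(grad (x + v) - grad x) (inv (blinfun_apply A) (grad (x + v) - grad x))
    \<le> C * (grad (x + v) - grad x) v"
proof -
  define g where "g = grad (x + v) - grad x"
  define w where "w = inv (blinfun_apply A) g"
  have Aw: "A w = g" by (simp add: w_def spd_inv_right[OF A])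
  obtain \<xi> where \<xi>: "0 < \<xi>" "\<xi> < 1"
    and mv: "g (v - (2 / C) *\<^sub>R w) = hess (x + \<xi> *\<^sub>R v) v (v - (2 / C) *\<^sub>R w)"
    unfolding g_def by (rule grad_mean_value)
  let ?h = "hess (x + \<xi> *\<^sub>R v)"
  have "0 \<le> ?h (v - (1 / C) *\<^sub>R w) (v - (1 / C) *\<^sub>R w)" by (rule spd_nonneg[OF spd_hess])
  also have "\<dots> = ?h v v - 2 / C * ?h v w + ?h w w / C\<^sup>2"
    using hess_sym[of "x + \<xi> *\<^sub>R v" w v] \<open>C > 0\<close>
    by (simp add: blinfun.diff_left blinfun.diff_right blinfun.scaleR_left blinfun.scaleR_right
        power2_eq_square field_simps)
  also have "\<dots> = ?h v (v - (2 / C) *\<^sub>R w) + ?h w w / C\<^sup>2"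
    by (simp add: blinfun.diff_right blinfun.scaleR_right)
  also have "\<dots> \<le> g (v - (2 / C) *\<^sub>R w) + C * A w w / C\<^sup>2"
    unfolding mv using le[OF \<xi>, of w] by (intro add_mono divide_right_mono) auto
  also have "\<dots> = g v - g w / C"
    using \<open>C > 0\<close> by (simp add: Aw blinfun.diff_right blinfun.scaleR_right power2_eq_square field_simps)
  finally show ?thesis using \<open>C > 0\<close> by (simp add: w_def g_def field_simps)
qed

lemma f_upper: "f (x + v) \<le> f x + grad x v + L / 2 * B v v"
  using second_order_upper_bound[OF DERIV_f_line[of x v] DERIV_grad_line[of x v v], of "L * B v v" 0]
    hess_quadratic_bounds(2) by simp

lemma f_lower: "f x + grad x v + \<mu> / 2 * B v v \<le> f (x + v)"
  using second_order_lower_bound[OF DERIV_f_line[of x v] DERIV_grad_line[of x v v], of "\<mu> * B v v" 0]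
    hess_quadratic_bounds(1) by simp

text \<open>The tangent at the intermediate point lies below \<open>f\<close> at both ends. Hence a
  decreasing step stays in the sublevel set as a whole, which controls the Hessian along it.\<close>

lemma f_segment_le:
  assumes "0 \<le> t" "t \<le> 1" "f (x + v) \<le> f x"
  shows "f (x + t *\<^sub>R v) \<le> f x"
proof -
  let ?z = "x + t *\<^sub>R v"
  have "f ?z + grad ?z w \<le> f (?z + w)" for w
    using f_lower[of ?z w] mu_pos spd_nonneg[OF spd_B, of w]
    by (smt (verit) mult_nonneg_nonneg divide_nonneg_pos)
  from this[of "- t *\<^sub>R v"] this[of "(1 - t) *\<^sub>R v"]
  have "f ?z + grad ?z (- t *\<^sub>R v) \<le> f x" "f ?z + grad ?z ((1 - t) *\<^sub>R v) \<le> f (x + v)"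
    by (simp_all add: algebra_simps)
  then have "f ?z - t * grad ?z v \<le> f x" and "f ?z + (1 - t) * grad ?z v \<le> f x"
    using assms(3) by (auto simp: blinfun.scaleR_right blinfun.minus_right)
  then have "(1 - t) * (f ?z - t * grad ?z v) + t * (f ?z + (1 - t) * grad ?z v) \<le> (1 - t) * f x + t * f x"
    using assms by (intro add_mono mult_left_mono) auto
  then show ?thesis by (simp add: algebra_simps)
qed

lemma grad_xstar: "grad xstar = 0"
proof -
  have "(\<lambda>v. grad xstar v) = (\<lambda>v. 0)"
    by (rule differential_zero_maxmin[of xstar UNIV f]) (auto simp: grad minimizer)
  then show ?thesis by (intro blinfun_eqI) (simp add: fun_eq_iff)
qed

lemma pnorm_xstar_le: "\<mu> * (pnorm B (y - xstar))\<^sup>2 \<le> 2 * (f y - f xstar)"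
  using f_lower[of xstar "y - xstar"] by (simp add: grad_xstar pnorm_square[OF spd_B])

text \<open>The Polyak-Lojasiewicz inequality: strong convexity at \<open>y\<close>, evaluated at
  the minimizer, followed by completing the square in the distance.\<close>

lemma gradient_dominance: "2 * \<mu> * (f y - f xstar) \<le> (dual_norm B (grad y))\<^sup>2"
proof -
  let ?u = "xstar - y"
  have "f y + grad y ?u + \<mu> / 2 * (pnorm B ?u)\<^sup>2 \<le> f xstar"
    using f_lower[of y ?u] by (simp add: pnorm_square[OF spd_B])
  moreover have "- grad y ?u \<le> dual_norm B (grad y) * pnorm B ?u"
    using abs_le_dual_norm[OF spd_B, of "grad y" ?u] by linarith
  ultimately have "f y - f xstar \<le> dual_norm B (grad y) * pnorm B ?u - \<mu> / 2 * (pnorm B ?u)\<^sup>2" by linarith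
  then have "2 * \<mu> * (f y - f xstar) \<le> 2 * \<mu> * (dual_norm B (grad y) * pnorm B ?u - \<mu> / 2 * (pnorm B ?u)\<^sup>2)"
    using mu_pos by (intro mult_left_mono) auto
  also have "\<dots> = (dual_norm B (grad y))\<^sup>2 - (dual_norm B (grad y) - \<mu> * pnorm B ?u)\<^sup>2"
    by (simp add: power2_eq_square algebra_simps)
  also have "\<dots> \<le> (dual_norm B (grad y))\<^sup>2" by simp
  finally show ?thesis .
qed

end

subsection \<open>The function psi and the dual BFGS update\<close>

lemma sum_basis_index:
  "(\<Sum>k\<in>UNIV. g (Rep_basis_index k)) = (\<Sum>b\<in>(Basis :: 'a::euclidean_space set). g b)"
proof -
  have "bij_betw Rep_basis_index UNIV (Basis :: 'a set)"
    by (simp add: bij_betw_def inj_on_def Rep_basis_index_inject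
        type_definition.Rep_range[OF type_definition_basis_index])
  then show ?thesis by (rule sum.reindex_bij_betw)
qed

lemma card_basis_index: "CARD('a::euclidean_space basis_index) = DIM('a)"
proof -
  have "(\<Sum>k\<in>(UNIV :: 'a basis_index set). 1 :: nat) = (\<Sum>b\<in>(Basis :: 'a set). 1)"
    by (rule sum_basis_index)
  then show ?thesis by simp
qed

lemma endo_matrix_comp:
  fixes S T :: "'a::euclidean_space \<Rightarrow> 'a"
  assumes S: "linear S"
  shows "endo_matrix (S \<circ> T) = endo_matrix S ** endo_matrix T"
proof -
  have "S (T b) \<bullet> c = (\<Sum>k\<in>Basis. (S k \<bullet> c) * (T b \<bullet> k))" for b c :: 'a
  proof -
    have "S (T b) = S (\<Sum>k\<in>Basis. (T b \<bullet> k) *\<^sub>R k)" by (simp add: euclidean_representation)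
    also have "\<dots> = (\<Sum>k\<in>Basis. (T b \<bullet> k) *\<^sub>R S k)" by (simp add: linear_sum[OF S] linear_scale[OF S])
    finally show ?thesis by (simp add: inner_sum_left mult.commute)
  qed
  then show ?thesis
    by (simp add: endo_matrix_def matrix_matrix_mult_def vec_eq_iff
        sum_basis_index[of "\<lambda>k. (S k \<bullet> c) * (T b \<bullet> k)" for b c])
qed

lemma endo_matrix_id: "endo_matrix (\<lambda>v::'a::euclidean_space. v) = mat 1"
  by (auto simp: endo_matrix_def mat_def vec_eq_iff inner_Basis Rep_basis_index Rep_basis_index_inject)

lemma endo_matrix_add: "endo_matrix (\<lambda>v. S v + T v) = endo_matrix S + endo_matrix T"
  by (simp add: endo_matrix_def vec_eq_iff inner_add_left)

lemma endo_matrix_diff: "endo_matrix (\<lambda>v. S v - T v) = endo_matrix S - endo_matrix T"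
  by (simp add: endo_matrix_def vec_eq_iff inner_diff_left)

lemma trace_endo_rank_one:
  fixes s :: "'a::euclidean_space dual"
  shows "trace (endo_matrix (\<lambda>v. s v *\<^sub>R a)) = s a"
proof -
  have "trace (endo_matrix (\<lambda>v. s v *\<^sub>R a)) = (\<Sum>b\<in>Basis. s b * (a \<bullet> b))"
    by (simp add: trace_def endo_matrix_def sum_basis_index[of "\<lambda>b. s b * (a \<bullet> b)"])
  also have "\<dots> = s (\<Sum>b\<in>Basis. (a \<bullet> b) *\<^sub>R b)"
    by (simp add: blinfun.sum_right blinfun.scaleR_right mult.commute)
  finally show ?thesis by (simp add: euclidean_representation)
qed

lemma trace_endo_id: "trace (endo_matrix (\<lambda>v::'a::euclidean_space. v)) = DIM('a)"
  by (simp add: endo_matrix_id trace_def mat_def card_basis_index)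

text \<open>Subtracting multiples of row \<open>k\<close> removes \<open>v\<close> from the other
  rows and leaves the identity with row \<open>k\<close> replaced by \<open>v\<close>, whose
  determinant Cramer's rule gives.\<close>

lemma det_unit_rows_update:
  fixes u v :: "real ^ 'n"
  assumes "finite S" "k \<notin> S"
  shows "det (\<chi> i. if i = k then v else if i \<in> S then axis i 1 + u $ i *s v else axis i 1) = v $ k"
  using assms
proof (induction S)
  case empty
  have row: "row i (mat 1) = (axis i 1 :: real ^ 'n)" for i
    by (auto simp: vec_eq_iff row_def mat_def axis_def)
  have "(\<Sum>i\<in>UNIV. v $ i *s axis i 1) = v"
    by (simp add: vec_eq_iff axis_def if_distrib cong: if_cong)
  then show ?case using cramer_lemma_transpose[of k v "mat 1"] by (simp only: row) (simp cong: if_cong)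
next
  case (insert m S)
  let ?A = "\<chi> i. if i = k then v else if i \<in> S then axis i 1 + u $ i *s v else axis i 1"
  have "m \<noteq> k" using insert by auto
  from det_row_operation[OF this, of ?A "u $ m"]
  have "det (\<chi> i. if i = m then row m ?A + u $ m *s row k ?A else row i ?A) = det ?A" .
  also have "(\<chi> i. if i = m then row m ?A + u $ m *s row k ?A else row i ?A)
    = (\<chi> i. if i = k then v else if i \<in> insert m S then axis i 1 + u $ i *s v else axis i 1)"
    using insert by (auto simp: vec_eq_iff row_def)
  finally show ?case using insert by simp
qed

text \<open>The matrix determinant lemma. Rows are perturbed one at a time; linearity in the new row
  splits off the determinant of \<open>det_unit_rows_update\<close>.\<close>

lemma det_rank_one_update:
  fixes u v :: "real ^ 'n"
  shows "det (\<chi> i. axis i 1 + u $ i *s v) = 1 + (\<Sum>i\<in>UNIV. u $ i * v $ i)"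
proof -
  have "det (\<chi> i. if i \<in> S then axis i 1 + u $ i *s v else axis i 1) = 1 + (\<Sum>i\<in>S. u $ i * v $ i)"
    if "finite S" for S
    using that
  proof (induction S)
    case empty
    have "(\<chi> i. axis i 1) = (mat 1 :: real ^ 'n ^ 'n)" by (auto simp: vec_eq_iff mat_def axis_def)
    then show ?case by simp
  next
    case (insert k S)
    let ?c = "\<lambda>i. if i \<in> S then axis i 1 + u $ i *s v else axis i 1"
    have split: "(\<chi> i. if i \<in> insert k S then axis i 1 + u $ i *s v else axis i 1)
      = (\<chi> i. if i = k then axis i 1 + u $ i *s v else ?c i)"
      by (auto simp: vec_eq_iff)
    have row_axis: "(\<chi> i. if i = k then axis i 1 else ?c i) = (\<chi> i. ?c i)"
      using insert by (auto simp: vec_eq_iff)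
    have "(\<chi> i. if i = k then u $ i *s v else ?c i) = (\<chi> i. if i = k then u $ k *s v else ?c i)"
      by (auto simp: vec_eq_iff)
    then have row_v: "det (\<chi> i. if i = k then u $ i *s v else ?c i) = u $ k * v $ k"
      using det_row_mul[of k "u $ k" "\<lambda>_. v" ?c] det_unit_rows_update[OF insert.hyps, of v u] by presburger
    show ?case
      using insert.IH insert.hyps unfolding split det_row_add row_axis row_v by simp
  qed
  from this[of UNIV] show ?thesis by simp
qed

lemma det_endo_rank_one:
  fixes s :: "'a::euclidean_space dual"
  shows "det (endo_matrix (\<lambda>v. v + s v *\<^sub>R a)) = 1 + s a"
proof -
  let ?u = "(\<chi> i. a \<bullet> Rep_basis_index i) :: real ^ 'a basis_index"
  let ?v = "(\<chi> i. s (Rep_basis_index i)) :: real ^ 'a basis_index"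
  have "endo_matrix (\<lambda>v. v + s v *\<^sub>R a) = (\<chi> i. axis i 1 + ?u $ i *s ?v)"
    by (auto simp: endo_matrix_def vec_eq_iff inner_add_left inner_Basis Rep_basis_index
        Rep_basis_index_inject axis_def)
  then have "det (endo_matrix (\<lambda>v. v + s v *\<^sub>R a)) = 1 + (\<Sum>i\<in>UNIV. ?u $ i * ?v $ i)"
    by (simp only: det_rank_one_update)
  also have "(\<Sum>i\<in>UNIV. ?u $ i * ?v $ i) = (\<Sum>b\<in>Basis. s b * (a \<bullet> b))"
    by (simp add: sum_basis_index[of "\<lambda>b. s b * (a \<bullet> b)", symmetric] mult.commute)
  also have "\<dots> = s (\<Sum>b\<in>Basis. (a \<bullet> b) *\<^sub>R b)"
    by (simp add: blinfun.sum_right blinfun.scaleR_right mult.commute)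
  finally show ?thesis by (simp add: euclidean_representation)
qed

lemma linear_spd_inv_comp:
  fixes X Y :: "'a::euclidean_space \<Rightarrow>\<^sub>L 'a dual"
  assumes "spd X" shows "linear (inv (blinfun_apply X) \<circ> blinfun_apply Y)"
  by (intro linear_compose linear_spd_inv assms bounded_linear.linear blinfun.bounded_linear_right)

text \<open>Needed to split the logarithm of a product in \<open>psi_bfgs_dual\<close>, where
  \<open>ln_mult\<close> asks for nonzero factors.\<close>

lemma det_endo_spd_nonzero:
  fixes X Y :: "'a::euclidean_space \<Rightarrow>\<^sub>L 'a dual"
  assumes X: "spd X" and Y: "spd Y"
  shows "det (endo_matrix (inv (blinfun_apply X) \<circ> blinfun_apply Y)) \<noteq> 0"
proof -
  let ?S = "inv (blinfun_apply X) \<circ> blinfun_apply Y"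
  let ?T = "inv (blinfun_apply Y) \<circ> blinfun_apply X"
  have "?S \<circ> ?T = (\<lambda>v. v)"
    by (simp add: fun_eq_iff spd_inv_left[OF X] spd_inv_right[OF Y])
  then have "endo_matrix ?S ** endo_matrix ?T = mat 1"
    by (metis endo_matrix_comp[OF linear_spd_inv_comp[OF X]] endo_matrix_id)
  then have "det (endo_matrix ?S) * det (endo_matrix ?T) = 1"
    by (metis det_mul det_I)
  then show ?thesis by auto
qed

lemma psi_eq:
  fixes X Y :: "'a::euclidean_space \<Rightarrow>\<^sub>L 'a dual"
  assumes X: "spd X"
  shows "psi X Y = trace (endo_matrix (inv (blinfun_apply X) \<circ> blinfun_apply Y)) - DIM('a)
    - ln (det (endo_matrix (inv (blinfun_apply X) \<circ> blinfun_apply Y)))"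
proof -
  have "inv (blinfun_apply X) \<circ> blinfun_apply (Y - X)
    = (\<lambda>v. (inv (blinfun_apply X) \<circ> blinfun_apply Y) v - v)"
    by (simp add: fun_eq_iff blinfun.diff_left linear_diff[OF linear_spd_inv[OF X]] spd_inv_left[OF X])
  then have "endo_matrix (inv (blinfun_apply X) \<circ> blinfun_apply (Y - X))
    = endo_matrix (inv (blinfun_apply X) \<circ> blinfun_apply Y) - endo_matrix (\<lambda>v. v)"
    by (simp only: endo_matrix_diff)
  then show ?thesis
    by (simp only: psi_def trace_sub trace_endo_id)
qed

lemma psi_scaleR:
  fixes B :: "'a::euclidean_space \<Rightarrow>\<^sub>L 'a dual"
  assumes B: "spd B" and "a > 0" "b > 0"
  shows "psi (a *\<^sub>R B) (b *\<^sub>R B) = DIM('a) * (b / a - 1 - ln (b / a))"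
proof -
  let ?T = "inv (blinfun_apply (a *\<^sub>R B)) \<circ> blinfun_apply (b *\<^sub>R B)"
  have aB: "spd (a *\<^sub>R B)" using spd_scaleR[OF B] assms by simp
  have T: "?T = (\<lambda>v. (b / a) *\<^sub>R v)"
  proof
    fix v
    have "(a *\<^sub>R B) ((b / a) *\<^sub>R v) = (b *\<^sub>R B) v"
      using assms by (simp add: blinfun.scaleR_left blinfun.scaleR_right)
    then show "?T v = (b / a) *\<^sub>R v" unfolding o_apply by (rule spd_inv_eqI[OF aB])
  qed
  have M: "endo_matrix (\<lambda>v::'a. (b / a) *\<^sub>R v) = mat (b / a)"
    by (auto simp: endo_matrix_def mat_def vec_eq_iff inner_Basis Rep_basis_index Rep_basis_index_inject)
  have "det (mat (b / a) :: real ^ 'a basis_index ^ 'a basis_index) = (b / a) ^ DIM('a)"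
    by (subst det_diagonal) (auto simp: mat_def card_basis_index)
  moreover have "trace (mat (b / a) :: real ^ 'a basis_index ^ 'a basis_index) = DIM('a) * (b / a)"
    by (simp add: trace_def mat_def card_basis_index)
  moreover have "ln ((b / a) ^ DIM('a)) = DIM('a) * ln (b / a)"
    using assms by (simp add: ln_realpow)
  ultimately show ?thesis
    unfolding psi_eq[OF aB] T M by (simp add: algebra_simps)
qed

section \<open>The dual BFGS update and its effect on psi\<close>

definition bfgs_dual ::
    "('a::euclidean_space \<Rightarrow>\<^sub>L 'a dual) \<Rightarrow> 'a \<Rightarrow> 'a dual \<Rightarrow> ('a \<Rightarrow>\<^sub>L 'a dual)" where
  "bfgs_dual G \<delta> \<gamma> = G - (1 / G \<delta> \<delta>) *\<^sub>R (blinfun_scaleR_left (G \<delta>) o\<^sub>L G \<delta>) + (1 / \<gamma> \<delta>) *\<^sub>R (blinfun_scaleR_left \<gamma> o\<^sub>L \<gamma>)"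

lemma bfgs_dual_apply:
  "bfgs_dual G \<delta> \<gamma> v = G v - (G \<delta> v / G \<delta> \<delta>) *\<^sub>R G \<delta> + (\<gamma> v / \<gamma> \<delta>) *\<^sub>R \<gamma>"
  by (simp add: bfgs_dual_def blinfun.add_left blinfun.diff_left blinfun.scaleR_left)

context
  fixes G :: "'a::euclidean_space \<Rightarrow>\<^sub>L 'a dual" and \<delta> :: 'a and \<gamma> :: "'a dual"
  assumes G: "spd G" and pos: "\<gamma> \<delta> > 0"
begin

lemma bfgs_curvature_pos: "G \<delta> \<delta> > 0"
proof (rule spd_pos[OF G])
  show "\<delta> \<noteq> 0" using pos by auto
qed

lemma spd_bfgs_dual: "spd (bfgs_dual G \<delta> \<gamma>)"
proof -
  let ?c = "G \<delta> \<delta>"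
  note c = bfgs_curvature_pos
  have "bfgs_dual G \<delta> \<gamma> u u > 0" if u: "u \<noteq> 0" for u
  proof -
    have eq: "bfgs_dual G \<delta> \<gamma> u u = (G u u - (G \<delta> u)\<^sup>2 / ?c) + (\<gamma> u)\<^sup>2 / \<gamma> \<delta>"
      by (simp add: bfgs_dual_apply blinfun.add_left blinfun.diff_left blinfun.scaleR_left power2_eq_square)
    \<comment> \<open>\<open>w\<close> is the component of \<open>u\<close> that is
      \<open>G\<close>-orthogonal to \<open>\<delta>\<close>. If it vanishes, \<open>u\<close> is a
      multiple of \<open>\<delta>\<close> and the \<open>\<gamma>\<close> term supplies
      positivity.\<close>
    define t where "t = G \<delta> u / ?c"
    define w where "w = u - t *\<^sub>R \<delta>"
    have w: "G u u - (G \<delta> u)\<^sup>2 / ?c = G w w"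
    proof -
      have "G w w = G u u - 2 * t * G \<delta> u + t\<^sup>2 * ?c"
        using spd_sym[OF G, of u \<delta>]
        by (simp add: w_def blinfun.diff_left blinfun.diff_right blinfun.scaleR_left
            blinfun.scaleR_right power2_eq_square algebra_simps)
      then show ?thesis using c by (simp add: t_def power2_eq_square field_simps)
    qed
    show ?thesis
    proof (cases "w = 0")
      case True
      then have u': "u = t *\<^sub>R \<delta>" by (simp add: w_def)
      then have "t \<noteq> 0" using u by auto
      then have "(\<gamma> u)\<^sup>2 / \<gamma> \<delta> > 0" using pos by (simp add: u' blinfun.scaleR_right)
      then show ?thesis unfolding eq w using True by simp
    next
      case False
      then show ?thesis unfolding eq w using spd_pos[OF G False] pos by (simp add: add_pos_nonneg)
    qed
  qed
  moreover have "bfgs_dual G \<delta> \<gamma> u v = bfgs_dual G \<delta> \<gamma> v u" for u v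
    using spd_sym[OF G, of u v]
    by (simp add: bfgs_dual_apply blinfun.add_left blinfun.diff_left blinfun.scaleR_left mult.commute)
  ultimately show ?thesis
    by (simp add: spd_def self_adjoint_def pos_def_def)
qed

lemma inv_bfgs_dual:
  "inv (blinfun_apply (bfgs_dual G \<delta> \<gamma>)) = bfgs_update (inv (blinfun_apply G)) \<delta> \<gamma>"
proof
  fix s :: "'a dual"
  let ?H = "inv (blinfun_apply G)" and ?e = "\<gamma> \<delta>" and ?c = "G \<delta> \<delta>"
  note c = bfgs_curvature_pos
  \<comment> \<open>The coefficients of the primal update. It is enough to check that the dual
    update sends the result back to \<open>s\<close>, since a positive definite operator is
    injective.\<close>
  define x1 where "x1 = s \<delta> / ?e"
  define x2 where "x2 = \<gamma> (?H s) / ?e"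
  define x3 where "x3 = (\<gamma> (?H \<gamma>) / ?e + 1) * x1"
  have upd: "bfgs_update ?H \<delta> \<gamma> s = ?H s - x1 *\<^sub>R ?H \<gamma> + (x3 - x2) *\<^sub>R \<delta>"
    by (simp add: bfgs_update_def x1_def x2_def x3_def scaleR_add_right scaleR_diff_left divide_inverse mult.commute
         mult.left_commute)
  have GH: "G (?H t) = t" for t by (rule spd_inv_right[OF G])
  have dH: "G \<delta> (?H t) = t \<delta>" for t using spd_sym[OF G, of \<delta> "?H t"] GH by simp
  let ?r = "bfgs_update ?H \<delta> \<gamma> s"
  have a: "G ?r = s - x1 *\<^sub>R \<gamma> + (x3 - x2) *\<^sub>R G \<delta>"
    by (simp add: upd GH blinfun.add_right blinfun.diff_right blinfun.scaleR_right)
  have b: "G \<delta> ?r / ?c = x3 - x2"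
    using c pos by (simp add: upd dH blinfun.add_right blinfun.diff_right blinfun.scaleR_right x1_def)
  have g: "\<gamma> ?r / ?e = x1"
    using pos by (simp add: upd blinfun.add_right blinfun.diff_right blinfun.scaleR_right x2_def x3_def field_simps)
  have "bfgs_dual G \<delta> \<gamma> ?r = s"
    unfolding bfgs_dual_apply a b g by simp
  then show "inv (blinfun_apply (bfgs_dual G \<delta> \<gamma>)) s = ?r"
    by (rule spd_inv_eqI[OF spd_bfgs_dual])
qed

text \<open>The trace changes by the traces of two rank-one maps. For the determinant, the new
  operator is \<open>G\<close> composed with a rank-two perturbation of the identity, which is
  factored into two rank-one perturbations.\<close>

lemma psi_bfgs_dual:
  fixes X :: "'a::euclidean_space \<Rightarrow>\<^sub>L 'a dual"
  assumes X: "spd X"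
  shows "psi X G - psi X (bfgs_dual G \<delta> \<gamma>)
    = G \<delta> (inv (blinfun_apply X) (G \<delta>)) / G \<delta> \<delta> - \<gamma> (inv (blinfun_apply X) \<gamma>) / \<gamma> \<delta> + ln (\<gamma> \<delta> / G \<delta> \<delta>)"
proof -
  let ?Xi = "inv (blinfun_apply X)" and ?Gi = "inv (blinfun_apply G)" and ?e = "\<gamma> \<delta>" and ?c = "G \<delta> \<delta>"
  note c = bfgs_curvature_pos
  note Xlin = linear_spd_inv[OF X]
  let ?T = "?Xi \<circ> blinfun_apply G" and ?T' = "?Xi \<circ> blinfun_apply (bfgs_dual G \<delta> \<gamma>)"
  have "?T' = (\<lambda>v. (?T v - G \<delta> v *\<^sub>R ((1 / ?c) *\<^sub>R ?Xi (G \<delta>))) + \<gamma> v *\<^sub>R ((1 / ?e) *\<^sub>R ?Xi \<gamma>))"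
    by (simp add: fun_eq_iff bfgs_dual_apply linear_add[OF Xlin] linear_diff[OF Xlin] linear_scale[OF Xlin])
  then have "trace (endo_matrix ?T')
      = trace (endo_matrix ?T) - G \<delta> ((1 / ?c) *\<^sub>R ?Xi (G \<delta>)) + \<gamma> ((1 / ?e) *\<^sub>R ?Xi \<gamma>)"
    by (simp only: endo_matrix_add endo_matrix_diff trace_add trace_sub trace_endo_rank_one)
  then have tr: "trace (endo_matrix ?T')
      = trace (endo_matrix ?T) - G \<delta> (?Xi (G \<delta>)) / ?c + \<gamma> (?Xi \<gamma>) / ?e"
    by (simp add: blinfun.scaleR_right)
  define q where "q = (1 / ?e) *\<^sub>R ?Gi \<gamma>"
  define p where "p = (1 / ?c) *\<^sub>R G \<delta>"
  have gq: "1 + \<gamma> q > 0"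
    using pos spd_inv_nonneg[OF G, of \<gamma>] by (simp add: q_def blinfun.scaleR_right add_pos_nonneg)
  have pq: "p q = 1 / ?c"
    using pos spd_sym[OF G, of \<delta> "?Gi \<gamma>"] spd_inv_right[OF G, of \<gamma>]
    by (simp add: p_def q_def blinfun.scaleR_right blinfun.scaleR_left)
  have pd: "p \<delta> = 1" using c by (simp add: p_def blinfun.scaleR_left)
  \<comment> \<open>The preimage of \<open>\<delta>\<close> under \<open>P\<close>, so that
    \<open>P \<circ> Q\<close> subtracts \<open>p v *\<^sub>R \<delta>\<close> after the
    \<open>\<gamma>\<close> term has been added. The determinant is then
    \<open>(1 + \<gamma> q) * (1 - p w)\<close>.\<close>
  define w where "w = \<delta> - (?e / (1 + \<gamma> q)) *\<^sub>R q"
  define P where "P = (\<lambda>v. v + \<gamma> v *\<^sub>R q)"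
  define Q where "Q = (\<lambda>v. v + p v *\<^sub>R (- w))"
  have linP: "linear P"
    by (rule linearI) (auto simp: P_def blinfun.add_right blinfun.scaleR_right algebra_simps)
  have Pw: "P w = \<delta>"
  proof -
    have "\<gamma> w = ?e / (1 + \<gamma> q)"
      using gq by (simp add: w_def blinfun.diff_right blinfun.scaleR_right field_simps)
    then show ?thesis by (simp add: P_def w_def)
  qed
  have PQ: "P (Q v) = v + \<gamma> v *\<^sub>R q - p v *\<^sub>R \<delta>" for v
    using linear_add[OF linP, of v "p v *\<^sub>R (- w)"] linear_scale[OF linP, of "- p v" w] Pw
    by (simp add: Q_def P_def)
  have TPQ: "?T' = ?T \<circ> (P \<circ> Q)"
  proof
    fix v
    have "bfgs_dual G \<delta> \<gamma> v = G (P (Q v))"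
      by (simp add: PQ bfgs_dual_apply p_def q_def blinfun.add_right blinfun.diff_right
          blinfun.scaleR_right blinfun.scaleR_left spd_inv_right[OF G])
    then show "?T' v = (?T \<circ> (P \<circ> Q)) v" by simp
  qed
  have "p w = 1 - ?e / (1 + \<gamma> q) / ?c"
    by (simp add: w_def blinfun.diff_right blinfun.scaleR_right pd pq)
  then have "det (endo_matrix P) * det (endo_matrix Q) = ?e / ?c"
    using gq c unfolding P_def Q_def det_endo_rank_one
    by (simp add: blinfun.minus_right)
  then have det: "det (endo_matrix ?T') = det (endo_matrix ?T) * (?e / ?c)"
    unfolding TPQ endo_matrix_comp[OF linear_spd_inv_comp[OF X]] endo_matrix_comp[OF linP] det_mul
    by simp
  have "ln (det (endo_matrix ?T')) = ln (det (endo_matrix ?T)) + ln (?e / ?c)"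
    unfolding det using det_endo_spd_nonzero[OF X G] pos c by (subst ln_mult) simp
  then show ?thesis by (simp add: psi_eq[OF X] tr)
qed

end

text \<open>BFGS updates with \<open>\<gamma> = X \<delta>\<close>, taken along directions that are \<open>X\<close>-orthogonal to the space where
  the two operators agree, do not increase \<open>psi\<close> and turn \<open>Y\<close> into \<open>X\<close> in finitely many steps.\<close>

lemma psi_nonneg:
  fixes X Y :: "'a::euclidean_space \<Rightarrow>\<^sub>L 'a dual"
  assumes X: "spd X" and "spd Y"
  shows "psi X Y \<ge> 0"
  using \<open>spd Y\<close>
proof (induction "DIM('a) - dim {v. X v = Y v}" arbitrary: Y rule: less_induct)
  case less
  note Y = less.prems
  define W where "W = {v. X v = Y v}"
  have W: "subspace W"
    by (auto simp: W_def subspace_def blinfun.add_right blinfun.scaleR_right)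
  show ?case
  proof (cases "W = UNIV")
    case True
    then have "X v = Y v" for v by (auto simp: W_def)
    then have "Y = X" by (intro blinfun_eqI) simp
    moreover have "inv (blinfun_apply X) \<circ> blinfun_apply X = (\<lambda>v. v)"
      by (simp add: fun_eq_iff spd_inv_left[OF X])
    ultimately show ?thesis
      by (simp only: psi_eq[OF X] trace_endo_id) (simp add: endo_matrix_id)
  next
    case False
    then have "span W \<subset> span UNIV" using W by (simp add: span_eq_iff[THEN iffD2] psubset_eq)
    then obtain z where z: "z \<noteq> 0" "\<And>y. y \<in> W \<Longrightarrow> z \<bullet> y = 0"
      using orthogonal_to_subspace_exists_gen[of W UNIV] W
      by (metis orthogonal_def span_base)
    \<comment> \<open>Solving \<open>X d = z\<close> turns Euclidean orthogonality to
      \<open>W\<close> into \<open>X\<close>-orthogonality. As \<open>X\<close> and \<open>Y\<close>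
      agree on \<open>W\<close>, \<open>d\<close> is also \<open>Y\<close>-orthogonal to it, so the
      update changes nothing there.\<close>
    define d where "d = inv (blinfun_apply X) (blinfun_inner_right z)"
    have Xd: "X d v = z \<bullet> v" for v
      by (simp add: d_def spd_inv_right[OF X])
    have "d \<noteq> 0" using Xd[of z] z(1) by auto
    note e = spd_pos[OF X this]
    note c = spd_pos[OF Y \<open>d \<noteq> 0\<close>]
    define Y' where "Y' = bfgs_dual Y d (X d)"
    have Y': "spd Y'" unfolding Y'_def using Y e by (rule spd_bfgs_dual)
    have "W \<subseteq> {v. X v = Y' v}"
    proof
      fix v assume v: "v \<in> W"
      then have "X d v = 0" using z Xd by simp
      moreover have "Y d v = 0"
        using v \<open>X d v = 0\<close> spd_sym[OF X, of d v] spd_sym[OF Y, of d v] by (simp add: W_def)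
      ultimately show "v \<in> {v. X v = Y' v}" using v by (simp add: Y'_def bfgs_dual_apply W_def)
    qed
    moreover have "d \<in> {v. X v = Y' v}" using e c by (simp add: Y'_def bfgs_dual_apply)
    moreover have "d \<notin> W" using z(2)[of d] Xd[of d] e by auto
    moreover have sub: "subspace {v. X v = Y' v}"
      by (auto simp: subspace_def blinfun.add_right blinfun.scaleR_right)
    ultimately have "span W \<subset> span {v. X v = Y' v}"
      using W by (metis psubsetI span_eq_iff)
    then have "dim W < dim {v. X v = Y' v}" by (rule dim_psubset)
    moreover have "dim {v. X v = Y' v} \<le> DIM('a)" by (rule dim_subset_UNIV)
    ultimately have "0 \<le> psi X Y'"
      using less.hyps[OF _ Y'] by (simp add: W_def diff_less_mono2)
    \<comment> \<open>For \<open>\<gamma> = X d\<close> the second quotient is 1 and Cauchy-Schwarz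
      bounds the first from below by \<open>?c / ?e\<close>, which leaves a value of
      \<open>t - 1 - ln t\<close>.\<close>
    moreover have "0 \<le> psi X Y - psi X Y'"
    proof -
      let ?e = "X d d" and ?c = "Y d d"
      have "?c\<^sup>2 \<le> Y d (inv (blinfun_apply X) (Y d)) * ?e"
        by (rule spd_dual_Cauchy_Schwarz[OF X])
      then have "?c / ?e \<le> Y d (inv (blinfun_apply X) (Y d)) / ?c"
        using e c by (simp add: field_simps power2_eq_square)
      moreover have "ln (?c / ?e) \<le> ?c / ?e - 1" using e c by (intro ln_le_minus_one) simp
      moreover have "ln (?e / ?c) = - ln (?c / ?e)" using e c by (simp add: ln_div)
      ultimately show ?thesis
        unfolding Y'_def psi_bfgs_dual[OF Y e X] spd_inv_left[OF X] using e by simp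
    qed
    ultimately show ?thesis by linarith
  qed
qed

text \<open>The maximum is 4/e, attained at 2; \<open>exp_ge_add_one_self\<close> is applied so as
  to be sharp there. This bound serves unit steps, \<open>times_exp_le_one\<close> shortened
  ones.\<close>

lemma square_exp_le_two:
  assumes "\<alpha> > (0::real)" shows "\<alpha>\<^sup>2 * exp (1 - \<alpha>) \<le> 2"
proof -
  have "1 + (\<alpha> / 2 - 1) \<le> exp (\<alpha> / 2 - 1)" by (rule exp_ge_add_one_self)
  then have "(\<alpha> / 2)\<^sup>2 \<le> (exp (\<alpha> / 2 - 1))\<^sup>2" using assms by (intro power_mono) auto
  also have "\<dots> = exp (\<alpha> - 2)" by (simp flip: exp_double)
  finally have "\<alpha>\<^sup>2 * exp (1 - \<alpha>) \<le> 4 * exp (\<alpha> - 2) * exp (1 - \<alpha>)"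
    by (intro mult_right_mono) (auto simp: power_divide)
  also have "\<dots> = 4 * exp (-1)" by (simp flip: exp_add)
  also have "\<dots> \<le> 2"
    using exp_ge_add_one_self[of 1] by (simp add: exp_minus field_simps)
  finally show ?thesis .
qed

lemma times_exp_le_one: "\<alpha> * exp (1 - \<alpha>) \<le> (1::real)"
proof -
  have "\<alpha> * exp (1 - \<alpha>) \<le> exp (\<alpha> - 1) * exp (1 - \<alpha>)"
    using exp_ge_add_one_self[of "\<alpha> - 1"] by (intro mult_right_mono) auto
  also have "\<dots> = 1" by (simp flip: exp_add)
  finally show ?thesis .
qed

section \<open>The BFGS iteration and its line search\<close>

locale bfgs_run = strongly_convex_smooth B f grad hess \<mu> L L2 xstar
  for B :: "'a::euclidean_space \<Rightarrow>\<^sub>L 'a dual" and f grad hess \<mu> L L2 xstar +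
  fixes x :: "nat \<Rightarrow> 'a" and Hop :: "nat \<Rightarrow> 'a dual \<Rightarrow> 'a" and h :: "nat \<Rightarrow> real"
    and \<eta> \<mu>0 :: real
  assumes eta_pos: "0 < \<eta>" and eta_less: "\<eta> < 1 / 2"
    and mu0_ge: "\<mu> \<le> \<mu>0" and mu0_le: "\<mu>0 \<le> L"
    and init: "Hop 0 = inv (blinfun_apply (\<mu>0 *\<^sub>R B))"
    and bfgs: "bfgs_iterates grad h x Hop"
    and step: "\<And>k. backtracking f grad \<eta> (x k) (Hop k (grad (x k))) (h k)"
    and standing: "\<And>k. (grad (x (Suc k)) - grad (x k)) (x (Suc k) - x k) > 0"
begin

definition \<kappa> :: real where "\<kappa> = L / \<mu>"

definition F :: "nat \<Rightarrow> real" where "F k = f (x k) - f xstar"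

definition d :: "nat \<Rightarrow> 'a" where "d k = Hop k (grad (x k))"

definition \<delta> :: "nat \<Rightarrow> 'a" where "\<delta> k = x (Suc k) - x k"

definition \<gamma> :: "nat \<Rightarrow> 'a dual" where "\<gamma> k = grad (x (Suc k)) - grad (x k)"

primrec G :: "nat \<Rightarrow> ('a \<Rightarrow>\<^sub>L 'a dual)" where
  "G 0 = \<mu>0 *\<^sub>R B"
| "G (Suc k) = bfgs_dual (G k) (\<delta> k) (\<gamma> k)"

lemma kappa_ge_1: "\<kappa> \<ge> 1"
  using mu_pos mu0_ge mu0_le by (simp add: \<kappa>_def)

lemma gamma_delta_pos: "\<gamma> k (\<delta> k) > 0"
  using standing by (simp add: \<gamma>_def \<delta>_def)

lemma spd_G: "spd (G k)"
  using mu0_ge mu_pos by (induction k) (auto intro!: spd_scaleR spd_B spd_bfgs_dual gamma_delta_pos)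

lemma Hop_eq: "Hop k = inv (blinfun_apply (G k))"
proof (induction k)
  case (Suc k)
  have "Hop (Suc k) = bfgs_update (Hop k) (\<delta> k) (\<gamma> k)"
    using bfgs by (simp add: bfgs_iterates_def \<delta>_def \<gamma>_def)
  then show ?case by (simp add: Suc inv_bfgs_dual[OF spd_G gamma_delta_pos])
qed (simp add: init)

lemma G_d: "G k (d k) = grad (x k)"
  by (simp add: d_def Hop_eq spd_inv_right[OF spd_G])

lemma h_pos: "h k > 0"
  using bfgs by (simp add: bfgs_iterates_def)

lemma delta_eq: "\<delta> k = - h k *\<^sub>R d k"
  using bfgs by (simp add: bfgs_iterates_def \<delta>_def d_def)

lemma x_Suc: "x (Suc k) = x k + \<delta> k"
  by (simp add: \<delta>_def)

lemma delta_nonzero: "\<delta> k \<noteq> 0"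
  using gamma_delta_pos[of k] by auto

lemma d_nonzero: "d k \<noteq> 0"
  using delta_nonzero[of k] by (auto simp: delta_eq)

lemma grad_d_pos: "grad (x k) (d k) > 0"
  using spd_pos[OF spd_G[of k] d_nonzero[of k]] by (simp add: G_d)

lemma armijo_decrease: "F (Suc k) \<le> F k - \<eta> * h k * grad (x k) (d k)"
  using step[of k] by (auto simp: backtracking_def armijo_def F_def x_Suc delta_eq d_def)

lemma unit_step_or_rejected:
  "h k = 1 \<or> f (x k) - f (x k - (2 * h k) *\<^sub>R d k) < \<eta> * (2 * h k) * grad (x k) (d k)"
proof -
  obtain i where i: "h k = (1/2) ^ i" "\<forall>j<i. \<not> armijo f grad \<eta> (x k) (d k) j"
    using step[of k] by (auto simp: backtracking_def d_def)
  show ?thesis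
  proof (cases i)
    case (Suc j)
    then have "\<not> armijo f grad \<eta> (x k) (d k) j" "(1/2) ^ j = 2 * h k" using i by auto
    then show ?thesis by (simp add: armijo_def)
  qed (use i in simp)
qed

lemma unit_step:
  assumes "\<eta> * grad (x k) (d k) \<le> f (x k) - f (x k - d k)"
  shows "h k = 1"
proof -
  obtain i where i: "h k = (1/2) ^ i" "\<forall>j<i. \<not> armijo f grad \<eta> (x k) (d k) j"
    using step[of k] by (auto simp: backtracking_def d_def)
  moreover have "armijo f grad \<eta> (x k) (d k) 0" using assms by (simp add: armijo_def)
  ultimately have "i = 0" by (metis gr0I)
  then show ?thesis using i by simp
qed

lemma F_nonneg: "F k \<ge> 0"
  using minimizer by (simp add: F_def)

lemma F_decreasing: "F (Suc k) < F k"
  using armijo_decrease[of k] eta_pos h_pos[of k] grad_d_pos[of k]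
  by (smt (verit) mult_pos_pos)

lemma F_pos: "F k > 0"
  using F_decreasing[of k] F_nonneg[of "Suc k"] by linarith

lemma F_antimono: "i \<le> j \<Longrightarrow> F j \<le> F i"
  by (rule lift_Suc_antimono_le[of F]) (auto intro: less_imp_le F_decreasing)

text \<open>As \<open>\<delta>\<close> is \<open>- h\<close> times \<open>d\<close>, both
  \<open>G \<delta>\<close> and \<open>\<delta>\<close> carry the step length: it cancels in the
  first quotient and survives squared under the logarithm.\<close>

lemma psi_step:
  assumes X: "spd X"
  shows "psi X (G k) - psi X (G (Suc k))
    = grad (x k) (inv (blinfun_apply X) (grad (x k))) / grad (x k) (d k)
      - \<gamma> k (inv (blinfun_apply X) (\<gamma> k)) / \<gamma> k (\<delta> k)
      + ln (\<gamma> k (\<delta> k) / ((h k)\<^sup>2 * grad (x k) (d k)))"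
proof -
  have Gd: "G k (\<delta> k) = - h k *\<^sub>R grad (x k)"
    by (simp add: delta_eq blinfun.minus_right blinfun.scaleR_right G_d)
  moreover have "G k (\<delta> k) (\<delta> k) = (h k)\<^sup>2 * grad (x k) (d k)"
    unfolding Gd by (simp add: delta_eq blinfun.minus_left blinfun.minus_right blinfun.scaleR_left
        blinfun.scaleR_right power2_eq_square)
  moreover have "(- h k *\<^sub>R grad (x k)) (inv (blinfun_apply X) (- h k *\<^sub>R grad (x k)))
    = (h k)\<^sup>2 * grad (x k) (inv (blinfun_apply X) (grad (x k)))"
    by (subst linear_scale[OF linear_spd_inv[OF X]])
      (simp add: blinfun.scaleR_left blinfun.scaleR_right blinfun.minus_left blinfun.minus_right
        power2_eq_square)
  ultimately show ?thesis
    using psi_bfgs_dual[OF spd_G gamma_delta_pos X, of k k] h_pos[of k] by simp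
qed

subsection \<open>Global linear convergence\<close>

text \<open>The first quotient of \<open>psi_step\<close> for \<open>X = L *\<^sub>R B\<close>. In
  \<open>p\<close> the second quotient is replaced by its upper bound 1, which is cocoercivity of
  the gradient.\<close>

definition \<alpha> :: "nat \<Rightarrow> real" where
  "\<alpha> k = (dual_norm B (grad (x k)))\<^sup>2 / (L * grad (x k) (d k))"

definition p :: "nat \<Rightarrow> real" where
  "p k = \<alpha> k - 1 + ln (\<gamma> k (\<delta> k) / ((h k)\<^sup>2 * grad (x k) (d k)))"

lemma dual_norm_grad_pos: "dual_norm B (grad (x k)) > 0"
proof -
  have "grad (x k) \<noteq> 0" using grad_d_pos[of k] by auto
  then show ?thesis using spd_inv_pos[OF spd_B] by (simp add: dual_norm_def)
qed

lemma alpha_pos: "\<alpha> k > 0"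
  using dual_norm_grad_pos[of k] grad_d_pos[of k] L_pos by (simp add: \<alpha>_def)

lemma spd_LB: "spd (L *\<^sub>R B)"
  using spd_scaleR[OF spd_B L_pos] .

lemma p_le_psi_step: "p k \<le> psi (L *\<^sub>R B) (G k) - psi (L *\<^sub>R B) (G (Suc k))"
proof -
  have inv: "inv (blinfun_apply (L *\<^sub>R B)) s = (1 / L) *\<^sub>R inv (blinfun_apply B) s" for s
    using L_pos by (intro spd_inv_eqI[OF spd_LB])
      (simp add: blinfun.scaleR_left blinfun.scaleR_right spd_inv_right[OF spd_B])
  have "\<gamma> k (inv (blinfun_apply (L *\<^sub>R B)) (\<gamma> k)) \<le> 1 * \<gamma> k (\<delta> k)"
    using cocoercive[OF spd_LB, of 1 "x k" "\<delta> k"] hess_quadratic_bounds(2)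
    by (simp add: \<gamma>_def x_Suc blinfun.scaleR_left)
  then have "\<gamma> k (inv (blinfun_apply (L *\<^sub>R B)) (\<gamma> k)) / \<gamma> k (\<delta> k) \<le> 1"
    using gamma_delta_pos by (simp add: divide_le_eq)
  moreover have "grad (x k) (inv (blinfun_apply (L *\<^sub>R B)) (grad (x k))) / grad (x k) (d k) = \<alpha> k"
    by (simp add: inv \<alpha>_def dual_norm_square[OF spd_B] blinfun.scaleR_right)
  ultimately show ?thesis
    unfolding psi_step[OF spd_LB] p_def by linarith
qed

lemma sum_p_le: "(\<Sum>i<k. p i) \<le> real DIM('a) * ln \<kappa>"
proof -
  have "(\<Sum>i<k. p i) \<le> (\<Sum>i<k. psi (L *\<^sub>R B) (G i) - psi (L *\<^sub>R B) (G (Suc i)))"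
    by (intro sum_mono p_le_psi_step)
  also have "\<dots> = psi (L *\<^sub>R B) (G 0) - psi (L *\<^sub>R B) (G k)"
    by (rule sum_lessThan_telescope')
  also have "\<dots> \<le> psi (L *\<^sub>R B) (\<mu>0 *\<^sub>R B)"
    using psi_nonneg[OF spd_LB spd_G] by simp
  also have "\<dots> = real DIM('a) * (\<mu>0 / L - 1 - ln (\<mu>0 / L))"
    using psi_scaleR[OF spd_B L_pos, of \<mu>0] mu0_ge mu_pos by simp
  also have "\<dots> \<le> real DIM('a) * ln \<kappa>"
  proof (intro mult_left_mono)
    have "ln \<mu> \<le> ln \<mu>0" using mu0_ge mu_pos by simp
    moreover have "\<mu>0 / L \<le> 1" using mu0_le L_pos by simp
    moreover have "ln (\<mu>0 / L) = ln \<mu>0 - ln L" "ln \<kappa> = ln L - ln \<mu>"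
      using mu0_ge mu_pos L_pos by (simp_all add: \<kappa>_def ln_div)
    ultimately show "\<mu>0 / L - 1 - ln (\<mu>0 / L) \<le> ln \<kappa>" by linarith
  qed simp
  finally show ?thesis .
qed

text \<open>For a unit step strong monotonicity bounds the curvature \<open>\<gamma> \<delta>\<close> from below, for a shorter one the
  rejected step of length \<open>2 h\<close> does.\<close>

lemma curvature_lower_bound: "exp (1 - \<alpha> k) * (h k * F k) \<le> \<kappa>\<^sup>2 * \<gamma> k (\<delta> k)"
proof -
  define y where "y = grad (x k) (d k)"
  define g where "g = dual_norm B (grad (x k))"
  note a = alpha_pos[of k]
  have y: "y > 0" using grad_d_pos by (simp add: y_def)
  have g: "g > 0" using dual_norm_grad_pos by (simp add: g_def)
  have yg: "y = g\<^sup>2 / (L * \<alpha> k)"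
    using y g L_pos by (simp add: \<alpha>_def y_def[symmetric] g_def[symmetric])
  have dom: "2 * \<mu> * F k \<le> g\<^sup>2" using gradient_dominance by (simp add: F_def g_def)
  have mono: "\<mu> * (pnorm B (\<delta> k))\<^sup>2 \<le> \<gamma> k (\<delta> k)"
    using strongly_monotone by (simp add: \<gamma>_def \<delta>_def)
  have k2: "\<kappa>\<^sup>2 = L\<^sup>2 / \<mu>\<^sup>2" by (simp add: \<kappa>_def power_divide)
  show ?thesis
  proof (cases "h k = 1")
    case True
    have "y \<le> g * pnorm B (\<delta> k)"
      using abs_le_dual_norm[OF spd_B, of "grad (x k)" "d k"] True
      by (simp add: y_def g_def delta_eq pnorm_minus)
    then have "\<mu> * y\<^sup>2 \<le> g\<^sup>2 * (\<mu> * (pnorm B (\<delta> k))\<^sup>2)"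
      using y mu_pos by (simp flip: power_mult_distrib add: mult.left_commute[of "g\<^sup>2"] power_mono)
    also have "\<dots> \<le> g\<^sup>2 * \<gamma> k (\<delta> k)" using mono by (intro mult_left_mono) auto
    finally have "\<mu> * g\<^sup>2 \<le> L\<^sup>2 * (\<alpha> k)\<^sup>2 * \<gamma> k (\<delta> k)"
      using g a L_pos by (simp add: yg power_divide power_mult_distrib field_simps power2_eq_square)
    moreover have "\<mu> * (2 * \<mu> * F k) \<le> \<mu> * g\<^sup>2"
      using dom mu_pos by (intro mult_left_mono) auto
    ultimately have "2 * \<mu>\<^sup>2 * F k \<le> L\<^sup>2 * (\<alpha> k)\<^sup>2 * \<gamma> k (\<delta> k)"
      by (simp add: power2_eq_square mult.left_commute mult.assoc)
    then have "2 * F k \<le> (\<alpha> k)\<^sup>2 * (\<kappa>\<^sup>2 * \<gamma> k (\<delta> k))"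
      using mu_pos by (simp add: k2 field_simps)
    \<comment> \<open>The 2 that gradient dominance left in front of \<open>F k\<close> is exactly
      what \<open>square_exp_le_two\<close> permits. In the other case the rejected step uses up
      that 2, and \<open>\<alpha>\<close> enters only linearly.\<close>
    moreover have "(\<alpha> k)\<^sup>2 * (exp (1 - \<alpha> k) * F k) \<le> 2 * F k"
      using mult_right_mono[OF square_exp_le_two[OF a], of "F k"] F_nonneg by (simp add: mult.assoc)
    ultimately have "(\<alpha> k)\<^sup>2 * (exp (1 - \<alpha> k) * F k) \<le> (\<alpha> k)\<^sup>2 * (\<kappa>\<^sup>2 * \<gamma> k (\<delta> k))" by linarith
    then show ?thesis using a True by simp
  next
    case False
    then have rej: "f (x k) - f (x k - (2 * h k) *\<^sub>R d k) < \<eta> * (2 * h k) * y"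
      using unit_step_or_rejected[of k] by (simp add: y_def)
    have "f (x k - (2 * h k) *\<^sub>R d k) \<le> f (x k) - 2 * h k * y + L / 2 * (4 * (pnorm B (\<delta> k))\<^sup>2)"
      using f_upper[of "x k" "- (2 * h k) *\<^sub>R d k"]
      by (simp add: y_def pnorm_square[OF spd_B] delta_eq blinfun.minus_left blinfun.minus_right
           blinfun.scaleR_left blinfun.scaleR_right mult.assoc mult.left_commute)
    with rej have "h k * y - \<eta> * (h k * y) \<le> L * (pnorm B (\<delta> k))\<^sup>2" by simp
    moreover have "\<eta> * (h k * y) \<le> 1 / 2 * (h k * y)"
      using eta_less h_pos[of k] y by (intro mult_right_mono) auto
    ultimately have "h k * y \<le> 2 * L * (pnorm B (\<delta> k))\<^sup>2" by linarith
    then have "\<mu> * (h k * y) \<le> 2 * L * (\<mu> * (pnorm B (\<delta> k))\<^sup>2)"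
      using mult_left_mono[of _ _ \<mu>] mu_pos by (simp add: mult.left_commute)
    also have "\<dots> \<le> 2 * L * \<gamma> k (\<delta> k)" using mono L_pos by (intro mult_left_mono) auto
    finally have "\<mu> * h k * g\<^sup>2 \<le> 2 * L\<^sup>2 * \<alpha> k * \<gamma> k (\<delta> k)"
      using L_pos a by (simp add: yg field_simps power2_eq_square)
    moreover have "\<mu> * h k * (2 * \<mu> * F k) \<le> \<mu> * h k * g\<^sup>2"
      using dom mu_pos h_pos[of k] by (intro mult_left_mono) auto
    ultimately have "2 * \<mu>\<^sup>2 * (h k * F k) \<le> 2 * L\<^sup>2 * \<alpha> k * \<gamma> k (\<delta> k)"
      by (simp add: power2_eq_square mult.left_commute mult.assoc)
    then have "h k * F k \<le> \<alpha> k * (\<kappa>\<^sup>2 * \<gamma> k (\<delta> k))"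
      using mu_pos by (simp add: k2 field_simps)
    moreover have "\<alpha> k * (exp (1 - \<alpha> k) * (h k * F k)) \<le> h k * F k"
      using mult_right_mono[OF times_exp_le_one[of "\<alpha> k"], of "h k * F k"] F_nonneg[of k] h_pos[of k]
      by (simp add: mult.assoc)
    ultimately have "\<alpha> k * (exp (1 - \<alpha> k) * (h k * F k)) \<le> \<alpha> k * (\<kappa>\<^sup>2 * \<gamma> k (\<delta> k))" by linarith
    then show ?thesis using a by simp
  qed
qed

text \<open>Multiplying \<open>F\<close> by \<open>exp (- p k)\<close> splits off the left side of
  \<open>curvature_lower_bound\<close>; the remaining factor turns its right side into a multiple of
  the Armijo decrease. Weakening \<open>exp (- p k)\<close> to \<open>1 - p k\<close> makes the
  exponents additive, so that \<open>sum_p_le\<close> applies.\<close>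

lemma F_contraction: "F (Suc k) \<le> exp (- (\<eta> / \<kappa>\<^sup>2 * (1 - p k))) * F k"
proof -
  define y where "y = grad (x k) (d k)"
  have y: "y > 0" using grad_d_pos by (simp add: y_def)
  note e = gamma_delta_pos[of k]
  note h = h_pos[of k]
  have \<kappa>: "\<kappa> > 0" using kappa_ge_1 by linarith
  have "exp (- p k) = exp (1 - \<alpha> k) * exp (- ln (\<gamma> k (\<delta> k) / ((h k)\<^sup>2 * y)))"
    by (simp add: p_def y_def flip: exp_add)
  also have "exp (- ln (\<gamma> k (\<delta> k) / ((h k)\<^sup>2 * y))) = (h k)\<^sup>2 * y / \<gamma> k (\<delta> k)"
    using y e h by (simp add: exp_minus)
  finally have ep: "exp (- p k) = exp (1 - \<alpha> k) * ((h k)\<^sup>2 * y / \<gamma> k (\<delta> k))" .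
  have "exp (- p k) * F k = (exp (1 - \<alpha> k) * (h k * F k)) * (h k * y / \<gamma> k (\<delta> k))"
    by (simp add: ep power2_eq_square)
  also have "\<dots> \<le> (\<kappa>\<^sup>2 * \<gamma> k (\<delta> k)) * (h k * y / \<gamma> k (\<delta> k))"
    using y e h by (intro mult_right_mono curvature_lower_bound) auto
  also have "\<dots> = \<kappa>\<^sup>2 * (h k * y)" using e by simp
  finally have "\<eta> * (exp (- p k) * F k) \<le> \<eta> * (\<kappa>\<^sup>2 * (h k * y))" using eta_pos by simp
  then have "\<eta> / \<kappa>\<^sup>2 * exp (- p k) * F k \<le> \<eta> * h k * y"
    using \<kappa> by (simp add: field_simps)
  then have "F (Suc k) \<le> (1 + - (\<eta> / \<kappa>\<^sup>2 * exp (- p k))) * F k"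
    using armijo_decrease[of k] by (simp add: y_def algebra_simps)
  also have "\<dots> \<le> exp (- (\<eta> / \<kappa>\<^sup>2 * exp (- p k))) * F k"
    using F_nonneg by (intro mult_right_mono exp_ge_add_one_self) auto
  also have "\<dots> \<le> exp (- (\<eta> / \<kappa>\<^sup>2 * (1 - p k))) * F k"
  proof -
    have "1 - p k \<le> exp (- p k)" using exp_ge_add_one_self[of "- p k"] by simp
    then have "\<eta> / \<kappa>\<^sup>2 * (1 - p k) \<le> \<eta> / \<kappa>\<^sup>2 * exp (- p k)"
      using eta_pos \<kappa> by (intro mult_left_mono) auto
    then show ?thesis using F_nonneg by (intro mult_right_mono) auto
  qed
  finally show ?thesis .
qed

lemma F_global_bound: "F k \<le> exp (- (\<eta> / \<kappa>\<^sup>2 * (real k - real DIM('a) * ln \<kappa>))) * F 0"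
proof -
  have "F k \<le> exp (- (\<eta> / \<kappa>\<^sup>2 * (\<Sum>i<k. 1 - p i))) * F 0"
  proof (induction k)
    case (Suc k)
    have "F (Suc k) \<le> exp (- (\<eta> / \<kappa>\<^sup>2 * (1 - p k))) * F k" by (rule F_contraction)
    also have "\<dots> \<le> exp (- (\<eta> / \<kappa>\<^sup>2 * (1 - p k))) * (exp (- (\<eta> / \<kappa>\<^sup>2 * (\<Sum>i<k. 1 - p i))) * F 0)"
      using Suc by simp
    also have "\<dots> = exp (- (\<eta> / \<kappa>\<^sup>2 * (\<Sum>i<Suc k. 1 - p i))) * F 0"
      by (simp add: distrib_left diff_divide_distrib algebra_simps flip: exp_add)
    finally show ?case .
  qed simp
  also have "\<dots> \<le> exp (- (\<eta> / \<kappa>\<^sup>2 * (real k - real DIM('a) * ln \<kappa>))) * F 0"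
  proof (intro mult_right_mono)
    have "real k - real DIM('a) * ln \<kappa> \<le> (\<Sum>i<k. 1 - p i)"
      using sum_p_le[of k] by (simp add: sum_subtractf)
    then have "\<eta> / \<kappa>\<^sup>2 * (real k - real DIM('a) * ln \<kappa>) \<le> \<eta> / \<kappa>\<^sup>2 * (\<Sum>i<k. 1 - p i)"
      using eta_pos by (intro mult_left_mono) auto
    then show "exp (- (\<eta> / \<kappa>\<^sup>2 * (\<Sum>i<k. 1 - p i)))
      \<le> exp (- (\<eta> / \<kappa>\<^sup>2 * (real k - real DIM('a) * ln \<kappa>)))" by simp
  qed (rule F_nonneg)
  finally show ?thesis .
qed

end

subsection \<open>Comparison with the Hessian at the minimizer\<close>

context strongly_convex_smooth
begin

abbreviation A :: "'a \<Rightarrow>\<^sub>L 'a dual" where "A \<equiv> hess xstar"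

definition H :: real where "H = sqrt 2 * L2 / \<mu> powr (3 / 2)"

text \<open>Bounds the relative deviation of the Hessian at \<open>y\<close> from the one at the
  minimizer: the Lipschitz bound in \<open>B\<close>, divided by the lower bound
  \<open>\<mu>\<close> of any Hessian.\<close>

definition \<zeta> :: "'a \<Rightarrow> real" where "\<zeta> y = L2 / \<mu> * pnorm B (y - xstar)"

lemma spd_A: "spd A"
  by (rule spd_hess)

lemma H_eq: "H = sqrt 2 * L2 / (\<mu> * sqrt \<mu>)"
proof -
  have "\<mu> powr (3 / 2) = \<mu> powr (1 + 1 / 2)" by simp
  also have "\<dots> = \<mu> * sqrt \<mu>" using mu_pos by (simp only: powr_add) (simp add: powr_half_sqrt)
  finally show ?thesis by (simp add: H_def)
qed

lemma H_nonneg: "H \<ge> 0"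
  using L2_nonneg by (simp add: H_def)

lemma zeta_nonneg: "\<zeta> y \<ge> 0"
  using L2_nonneg mu_pos pnorm_nonneg[OF spd_B] by (simp add: \<zeta>_def)

lemma sqrt_mu_pnorm_le: "sqrt \<mu> * pnorm B v \<le> pnorm A v"
  using hess_quadratic_bounds(1)[of v xstar] by (simp add: pnorm_def flip: real_sqrt_mult)

text \<open>The origin of \<open>H\<close>: quadratic growth of \<open>f\<close> bounds the distance
  to the minimizer by \<open>sqrt 2 / sqrt \<mu>\<close> times the root of the gap.\<close>

lemma zeta_le: "\<zeta> y \<le> H * sqrt (f y - f xstar)"
proof -
  have "sqrt \<mu> * pnorm B (y - xstar) \<le> sqrt 2 * sqrt (f y - f xstar)"
    using pnorm_xstar_le[of y] mu_pos pnorm_nonneg[OF spd_B] unfolding real_sqrt_mult[symmetric]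
    by (intro real_le_rsqrt) (simp add: power_mult_distrib)
  then have "L2 / (\<mu> * sqrt \<mu>) * (sqrt \<mu> * pnorm B (y - xstar)) \<le> L2 / (\<mu> * sqrt \<mu>) * (sqrt 2 * sqrt (f y - f xstar))"
    using L2_nonneg mu_pos by (intro mult_left_mono) auto
  then show ?thesis using mu_pos by (simp add: \<zeta>_def H_eq mult.commute mult.left_commute)
qed

lemma zeta_le_pnorm: "\<zeta> y \<le> L2 / (\<mu> * sqrt \<mu>) * pnorm A (y - xstar)"
proof -
  have "L2 / (\<mu> * sqrt \<mu>) * (sqrt \<mu> * pnorm B (y - xstar)) \<le> L2 / (\<mu> * sqrt \<mu>) * pnorm A (y - xstar)"
    using L2_nonneg mu_pos sqrt_mu_pnorm_le by (intro mult_left_mono) auto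
  then show ?thesis using mu_pos by (simp add: \<zeta>_def)
qed

text \<open>The deviation can be charged to either operator, both being at least
  \<open>\<mu> *\<^sub>R B\<close>. Charging it to \<open>hess y\<close> in the second comparison
  gives a lower bound with factor \<open>1 / (1 + \<zeta> y)\<close>, positive however far
  \<open>y\<close> is, where \<open>1 - \<zeta> y\<close> would not be.\<close>

lemma hess_xstar_comparison:
  "hess y w w \<le> (1 + \<zeta> y) * A w w" "A w w \<le> (1 + \<zeta> y) * hess y w w"
proof -
  have diff: "\<bar>hess y w w - A w w\<bar> \<le> L2 * pnorm B (y - xstar) * B w w"
    using hess_diff_le[of y w w xstar] by (simp add: mult.assoc pnorm_square[OF spd_B] flip: power2_eq_square)
  have "L2 * pnorm B (y - xstar) * B w w \<le> \<zeta> y * hess z w w" for z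
  proof -
    have "L2 * pnorm B (y - xstar) * B w w = \<zeta> y * (\<mu> * B w w)"
      using mu_pos by (simp add: \<zeta>_def)
    also have "\<dots> \<le> \<zeta> y * hess z w w"
      by (intro mult_left_mono hess_quadratic_bounds zeta_nonneg)
    finally show ?thesis .
  qed
  from this[of xstar] this[of y] diff
  show "hess y w w \<le> (1 + \<zeta> y) * A w w" "A w w \<le> (1 + \<zeta> y) * hess y w w"
    by (auto simp: algebra_simps)
qed

lemma zeta_line: "0 \<le> t \<Longrightarrow> \<zeta> (xstar + t *\<^sub>R u) = t * \<zeta> (xstar + u)"
  by (simp add: \<zeta>_def pnorm_scaleR[OF spd_B])

lemma f_xstar_upper: "2 * (f y - f xstar) \<le> (pnorm A (y - xstar))\<^sup>2 * (1 + \<zeta> y / 3)"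
proof -
  define u where "u = y - xstar"
  have y: "y = xstar + u" by (simp add: u_def)
  have "hess (xstar + t *\<^sub>R u) u u \<le> A u u + (A u u * \<zeta> y) * t" if "0 \<le> t" "t \<le> 1" for t
    using hess_xstar_comparison(1)[of "xstar + t *\<^sub>R u" u] zeta_line[OF that(1), of u]
    by (simp add: y algebra_simps)
  from second_order_upper_bound[OF DERIV_f_line[of xstar u] DERIV_grad_line[of xstar u u] this]
  show ?thesis by (simp add: grad_xstar pnorm_square[OF spd_A] y algebra_simps)
qed

text \<open>The lower bound \<open>1 / (1 + t \<zeta>)\<close> for the Hessian is replaced by its tangent at \<open>t = 1/3\<close>,
  the mean of \<open>t\<close> under the weight \<open>2 (1 - t)\<close> of Taylor's formula.\<close>

lemma f_xstar_lower: "(pnorm A (y - xstar))\<^sup>2 \<le> 2 * (f y - f xstar) * (1 + \<zeta> y / 3)"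
proof -
  define u where "u = y - xstar"
  have y: "y = xstar + u" by (simp add: u_def)
  define s where "s = 1 + \<zeta> y / 3"
  define R where "R = A u u"
  have s: "s > 0" using zeta_nonneg[of y] by (simp add: s_def)
  have R: "R \<ge> 0" by (simp add: R_def spd_nonneg[OF spd_A])
  have "R * (1 / s + \<zeta> y / (3 * s\<^sup>2)) + (- (R * \<zeta> y / s\<^sup>2)) * t \<le> hess (xstar + t *\<^sub>R u) u u"
    if t: "0 \<le> t" "t \<le> 1" for t
  proof -
    define z where "z = \<zeta> y * (t - 1 / 3)"
    have sz: "1 + t * \<zeta> y = s + z" by (simp add: s_def z_def algebra_simps)
    have pos: "s + z > 0" unfolding sz[symmetric] using zeta_nonneg[of y] t by (intro add_pos_nonneg) auto
    have "(s + z) * (1 / s - z / s\<^sup>2) = 1 - z\<^sup>2 / s\<^sup>2"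
      using s by (simp add: field_simps power2_eq_square)
    also have "\<dots> \<le> 1" by simp
    finally have "1 / s - z / s\<^sup>2 \<le> 1 / (s + z)" using pos by (simp add: field_simps)
    then have "R * (1 / s - z / s\<^sup>2) \<le> R * (1 / (s + z))" using R by (intro mult_left_mono)
    also have "\<dots> \<le> hess (xstar + t *\<^sub>R u) u u"
      using hess_xstar_comparison(2)[of u "xstar + t *\<^sub>R u"] zeta_line[OF t(1), of u] pos
      by (simp add: R_def y[symmetric] sz pos_divide_le_eq mult.commute)
    also have "R * (1 / s - z / s\<^sup>2) = R * (1 / s + \<zeta> y / (3 * s\<^sup>2)) + (- (R * \<zeta> y / s\<^sup>2)) * t"
      using s by (simp add: z_def field_simps power2_eq_square)
    finally show ?thesis .
  qed
  from second_order_lower_bound[OF DERIV_f_line[of xstar u] DERIV_grad_line[of xstar u u] this]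
  have "R * (1 / s + \<zeta> y / (3 * s\<^sup>2)) / 2 - R * \<zeta> y / s\<^sup>2 / 6 \<le> f y - f xstar"
    by (simp add: grad_xstar y[symmetric])
  moreover have "R * (1 / s + \<zeta> y / (3 * s\<^sup>2)) / 2 - R * \<zeta> y / s\<^sup>2 / 6 = R / (2 * s)"
    using s by (simp add: field_simps)
  ultimately have "R / (2 * s) \<le> f y - f xstar" by simp
  then show ?thesis
    using s by (simp add: R_def u_def[symmetric] pnorm_square[OF spd_A] s_def[symmetric] field_simps)
qed

text \<open>The intermediate point is only known to lie on the segment, hence
  \<open>\<zeta> y\<close> where the integral remainder would give half of it; the constants below
  are fitted to this value.\<close>

lemma grad_linearization:
  "dual_norm A (grad y - A (y - xstar)) \<le> \<zeta> y * pnorm A (y - xstar)"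
proof (rule dual_norm_leI[OF spd_A])
  define u where "u = y - xstar"
  have y: "y = xstar + u" by (simp add: u_def)
  fix v
  obtain \<xi> where \<xi>: "0 < \<xi>" "\<xi> < 1" "(grad (xstar + u) - grad xstar) v = hess (xstar + \<xi> *\<^sub>R u) u v"
    by (rule grad_mean_value)
  have "(grad y - A u) v \<le> \<bar>hess (xstar + \<xi> *\<^sub>R u) u v - A u v\<bar>"
    using \<xi>(3) by (simp add: y grad_xstar blinfun.diff_left)
  also have "\<dots> \<le> L2 * pnorm B (\<xi> *\<^sub>R u) * pnorm B u * pnorm B v"
    using hess_diff_le[of "xstar + \<xi> *\<^sub>R u" u v xstar] by simp
  also have "\<dots> \<le> L2 * pnorm B u * pnorm B u * pnorm B v"
    using \<xi> pnorm_nonneg[OF spd_B] L2_nonneg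
    by (intro mult_right_mono mult_left_mono) (auto simp: pnorm_scaleR[OF spd_B] mult_left_le_one_le)
  also have "\<dots> = \<zeta> y * ((sqrt \<mu> * pnorm B u) * (sqrt \<mu> * pnorm B v))"
  proof -
    have scaled: "(sqrt \<mu> * pnorm B u) * (sqrt \<mu> * pnorm B v) = \<mu> * pnorm B u * pnorm B v"
    proof -
      have "(sqrt \<mu> * pnorm B u) * (sqrt \<mu> * pnorm B v) = (sqrt \<mu>)\<^sup>2 * pnorm B u * pnorm B v"
        by (simp only: power2_eq_square mult_ac)
      then show ?thesis using mu_pos by simp
    qed
    show ?thesis unfolding scaled using mu_pos by (simp add: \<zeta>_def u_def)
  qed
  also have "\<dots> \<le> \<zeta> y * (pnorm A u * pnorm A v)"
    using mu_pos pnorm_nonneg[OF spd_B] pnorm_nonneg[OF spd_A]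
    by (intro mult_left_mono mult_mono sqrt_mu_pnorm_le zeta_nonneg) auto
  finally show "(grad y - A (y - xstar)) v \<le> \<zeta> y * pnorm A (y - xstar) * pnorm A v"
    by (simp add: u_def mult.assoc)
qed (simp add: zeta_nonneg pnorm_nonneg[OF spd_A])

end

section \<open>Scalar inequalities for the local analysis\<close>

lemma neg_ln_one_minus_lower:
  assumes "0 \<le> t" "t < (1::real)" shows "t + t\<^sup>2 / 2 \<le> - ln (1 - t)"
proof -
  have "\<exists>y. ((\<lambda>t. - ln (1 - t) - t - t\<^sup>2 / 2) has_real_derivative y) (at s) \<and> 0 \<le> y"
    if "0 \<le> s" "s \<le> t" for s
  proof -
    have "0 \<le> s\<^sup>2 / (1 - s)" using that assms by simp
    also have "s\<^sup>2 / (1 - s) = 1 / (1 - s) - 1 - s" using that assms by (simp add: field_simps power2_eq_square)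
    finally show ?thesis
      using that assms
      by (intro exI[of _ "1 / (1 - s) - 1 - s"] conjI) (auto intro!: derivative_eq_intros)
  qed
  from DERIV_nonneg_imp_nondecreasing[OF assms(1) this] show ?thesis by simp
qed

lemma diff_ln_antimono:
  assumes "0 < b" "b \<le> c" "c \<le> (1::real)" shows "c - 1 - ln c \<le> b - 1 - ln b"
proof -
  have "ln (b / c) \<le> b / c - 1" using assms by (intro ln_le_minus_one) auto
  moreover have "ln (b / c) = ln b - ln c" using assms by (simp add: ln_div)
  moreover have "(c - b) * c \<le> (c - b) * 1" using assms by (intro mult_left_mono) auto
  then have "b / c - 1 \<le> b - c" using assms by (simp add: field_simps)
  ultimately show ?thesis by linarith
qed

text \<open>Both sides split into a part measuring \<open>a - b\<close> and a part depending on
  \<open>b\<close>, compared separately. For \<open>b \<ge> 1\<close> the substitution of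
  \<open>sqrt b\<close> gives \<open>b - 1 - ln b \<ge> (sqrt b - 1)^2\<close>; below 1 the
  quadratic bound on the logarithm is used, with \<open>1 / b^2 \<le> 4\<close>. The threshold 0.55
  is 1 minus the bound 0.45 on \<open>tbar\<close>.\<close>

lemma newton_residual_le:
  assumes "0.55 \<le> (b::real)" "b \<le> a"
  shows "1 - 2 / a + 1 / (a * b) \<le> 8 * (a - 1 - ln b)"
proof -
  have u: "(1 - 1 / b)\<^sup>2 \<le> 8 * (b - 1 - ln b)"
  proof (cases "b \<ge> 1")
    case True
    have sb: "sqrt b \<ge> 1" "(sqrt b)\<^sup>2 = b" using True by auto
    have "ln b = 2 * ln (sqrt b)" using True by (simp add: ln_sqrt)
    also have "\<dots> \<le> 2 * (sqrt b - 1)" using sb by (intro mult_left_mono ln_le_minus_one) auto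
    finally have 1: "(sqrt b - 1)\<^sup>2 \<le> b - 1 - ln b"
      using sb by (simp add: power2_diff)
    have "1 - 1 / b = (sqrt b - 1) * (sqrt b + 1) / b"
      using True sb by (simp add: field_simps flip: power2_eq_square)
    also have "\<dots> \<le> 2 * (sqrt b - 1)"
    proof -
      have "sqrt b + 1 \<le> 2 * b" using mult_left_mono[OF sb(1), of "sqrt b"] sb True by (simp flip: power2_eq_square)
      then have "(sqrt b - 1) * (sqrt b + 1) \<le> (sqrt b - 1) * (2 * b)" using sb by (intro mult_left_mono) auto
      then show ?thesis using True by (simp add: field_simps)
    qed
    finally have "(1 - 1 / b)\<^sup>2 \<le> (2 * (sqrt b - 1))\<^sup>2" using True by (intro power_mono) auto
    also have "\<dots> = 4 * (sqrt b - 1)\<^sup>2" by (simp only: power_mult_distrib) simp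
    also have "\<dots> \<le> 8 * (b - 1 - ln b)"
      using 1 by (intro mult_mono) auto
    finally show ?thesis .
  next
    case False
    have "(1 - b)\<^sup>2 / 2 \<le> b - 1 - ln b" using neg_ln_one_minus_lower[of "1 - b"] False assms by simp
    moreover have "(1 - 1 / b)\<^sup>2 \<le> 4 * (1 - b)\<^sup>2"
    proof -
      have "0.55 * 0.55 \<le> b * b" using assms by (intro mult_mono) auto
      then have "1 / b\<^sup>2 \<le> 4" using assms by (simp add: field_simps power2_eq_square)
      then have "(1 / b\<^sup>2) * (1 - b)\<^sup>2 \<le> 4 * (1 - b)\<^sup>2" by (intro mult_right_mono) auto
      moreover have "(1 - 1 / b)\<^sup>2 = (1 / b\<^sup>2) * (1 - b)\<^sup>2"
        using assms by (simp add: field_simps power2_eq_square)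
      ultimately show ?thesis by simp
    qed
    ultimately show ?thesis by simp
  qed
  have "1 - 2 / a + 1 / (a * b) = (a - b) / a + b / a * (1 - 1 / b)\<^sup>2"
    using assms by (simp add: field_simps power2_eq_square)
  also have "(a - b) / a \<le> 8 * (a - b)"
  proof -
    have "(a - b) * 1 \<le> (a - b) * (8 * a)" using assms by (intro mult_left_mono) auto
    then show ?thesis using assms by (simp add: field_simps)
  qed
  also have "b / a * (1 - 1 / b)\<^sup>2 \<le> 1 * (8 * (b - 1 - ln b))"
    using assms u by (intro mult_mono) auto
  finally show ?thesis by simp
qed

lemma superlinear_factor_le:
  assumes "\<theta>\<^sup>2 \<le> 8 * q" shows "0.06 + 1.06 * \<theta> \<le> exp (- 1 + 20 * (q::real))"
proof -
  have "0.06 + 1.06 * \<theta> \<le> 100 / 272 * (1 + 20 * (\<theta>\<^sup>2 / 8))"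
  proof -
    \<comment> \<open>100/272 is a lower bound of 1/e, and 0.57664 = 1.06 / (5 * 100/272) is the
      vertex of the parabola in \<open>\<theta>\<close>. The coefficient 20 is close to the least
      one that keeps this parabola positive.\<close>
    have "0 \<le> 100 / 272 * 2.5 * (\<theta> - 0.57664)\<^sup>2 + (0.001 :: real)" by simp
    also have "\<dots> \<le> 100 / 272 * (1 + 20 * (\<theta>\<^sup>2 / 8)) - (0.06 + 1.06 * \<theta>)"
      by (simp add: power2_eq_square algebra_simps)
    finally show ?thesis by simp
  qed
  also have "\<dots> \<le> 100 / 272 * (1 + 20 * q)" using assms by simp
  also have "\<dots> \<le> exp (- 1) * (1 + 20 * q)"
  proof (intro mult_right_mono)
    show "100 / 272 \<le> exp (- 1 :: real)" using e_less_272 by (simp add: exp_minus field_simps)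
    show "0 \<le> 1 + 20 * q" using assms zero_le_power2[of \<theta>] by linarith
  qed
  also have "\<dots> \<le> exp (- 1) * exp (20 * q)" by (intro mult_left_mono exp_ge_add_one_self) auto
  finally show ?thesis by (simp add: exp_add[symmetric])
qed

subsection \<open>Local superlinear convergence\<close>

context bfgs_run
begin

definition \<sigma> :: "nat \<Rightarrow> real" where "\<sigma> k = sqrt (F k)"

definition r :: "nat \<Rightarrow> real" where "r k = pnorm A (x k - xstar)"

lemma sigma_nonneg: "\<sigma> k \<ge> 0"
  by (simp add: \<sigma>_def F_nonneg)

lemma r_nonneg: "r k \<ge> 0"
  by (simp add: r_def pnorm_nonneg[OF spd_A])

lemma zeta_x_le: "\<zeta> (x k) \<le> H * \<sigma> k"
  using zeta_le[of "x k"] by (simp add: \<sigma>_def F_def)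

lemma F_le_r: "2 * F k \<le> (r k)\<^sup>2 * (1 + H * \<sigma> k / 3)"
proof -
  have "2 * F k \<le> (r k)\<^sup>2 * (1 + \<zeta> (x k) / 3)" using f_xstar_upper by (simp add: F_def r_def)
  also have "\<dots> \<le> (r k)\<^sup>2 * (1 + H * \<sigma> k / 3)" using zeta_x_le by (intro mult_left_mono) auto
  finally show ?thesis .
qed

lemma r_le_F: "(r k)\<^sup>2 \<le> 2 * F k * (1 + H * \<sigma> k / 3)"
proof -
  have "(r k)\<^sup>2 \<le> 2 * F k * (1 + \<zeta> (x k) / 3)" using f_xstar_lower by (simp add: F_def r_def)
  also have "\<dots> \<le> 2 * F k * (1 + H * \<sigma> k / 3)"
    using zeta_x_le F_nonneg by (intro mult_left_mono) auto
  finally show ?thesis .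
qed

text \<open>\<open>r\<close> itself need not decrease, but \<open>F\<close> does, and
  \<open>r^2\<close> agrees with \<open>2 * F\<close> up to the factor
  \<open>1 + \<Delta> / 3\<close> in either direction.\<close>

lemma r_growth:
  assumes "H * \<sigma> k \<le> \<Delta>"
  shows "r (Suc k) \<le> (1 + \<Delta> / 3) * r k"
proof (rule power2_le_imp_le)
  have D: "0 \<le> \<Delta>" using assms H_nonneg sigma_nonneg[of k] by (meson mult_nonneg_nonneg order_trans)
  have "\<sigma> (Suc k) \<le> \<sigma> k" using F_decreasing[of k] by (simp add: \<sigma>_def)
  then have "H * \<sigma> (Suc k) \<le> \<Delta>" using assms H_nonneg mult_left_mono order_trans by blast
  then have "(r (Suc k))\<^sup>2 \<le> 2 * F (Suc k) * (1 + \<Delta> / 3)"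
    using r_le_F[of "Suc k"] mult_left_mono[of "1 + H * \<sigma> (Suc k) / 3" "1 + \<Delta> / 3" "2 * F (Suc k)"] F_nonneg
    by (meson add_left_mono divide_right_mono mult_nonneg_nonneg order_trans zero_le_numeral)
  also have "\<dots> \<le> 2 * F k * (1 + \<Delta> / 3)"
    using F_decreasing[of k] D by (intro mult_right_mono) auto
  also have "\<dots> \<le> ((r k)\<^sup>2 * (1 + \<Delta> / 3)) * (1 + \<Delta> / 3)"
  proof (intro mult_right_mono)
    show "2 * F k \<le> (r k)\<^sup>2 * (1 + \<Delta> / 3)"
      using F_le_r[of k] mult_left_mono[of "1 + H * \<sigma> k / 3" "1 + \<Delta> / 3" "(r k)\<^sup>2"] assms
      by (meson add_left_mono divide_right_mono order_trans zero_le_numeral zero_le_power2)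
  qed (use D in auto)
  finally show "(r (Suc k))\<^sup>2 \<le> ((1 + \<Delta> / 3) * r k)\<^sup>2" by (simp add: power2_eq_square mult_ac)
  show "0 \<le> (1 + \<Delta> / 3) * r k" using D r_nonneg by simp
qed

text \<open>Here \<open>b\<close> compares \<open>G k\<close> with \<open>A\<close> along
  \<open>d k\<close>, while \<open>a\<close> compares the inverses, in reciprocal form, at the
  gradient. Both are 1 if \<open>d k\<close> is the Newton direction for \<open>A\<close>.\<close>

definition a :: "nat \<Rightarrow> real" where
  "a k = (dual_norm A (grad (x k)))\<^sup>2 / grad (x k) (d k)"

definition b :: "nat \<Rightarrow> real" where
  "b k = grad (x k) (d k) / A (d k) (d k)"

text \<open>The decrease of \<open>psi A\<close> that \<open>psi_step\<close> would give if
  \<open>\<gamma> k\<close> were \<open>A (\<delta> k)\<close>, that is, for a quadratic function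
  with Hessian \<open>A\<close>.\<close>

definition q :: "nat \<Rightarrow> real" where
  "q k = a k - 1 - ln (b k)"

lemma A_d_pos: "A (d k) (d k) > 0"
  by (rule spd_pos[OF spd_A d_nonzero])

lemma b_pos: "b k > 0"
  using A_d_pos grad_d_pos by (simp add: b_def)

lemma b_le_a: "b k \<le> a k"
proof -
  have "(grad (x k) (d k))\<^sup>2 \<le> (dual_norm A (grad (x k)))\<^sup>2 * A (d k) (d k)"
    unfolding dual_norm_square[OF spd_A] by (rule spd_dual_Cauchy_Schwarz[OF spd_A])
  then show ?thesis
    using A_d_pos[of k] grad_d_pos[of k] by (simp add: a_def b_def field_simps power2_eq_square)
qed

lemma q_ge: "b k - 1 - ln (b k) \<le> q k"
  using b_le_a by (simp add: q_def)

lemma q_nonneg: "q k \<ge> 0"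
  using q_ge[of k] ln_le_minus_one[OF b_pos[of k]] by linarith

lemma zeta_segment:
  assumes "0 \<le> t" "t \<le> 1" shows "\<zeta> (x k + t *\<^sub>R \<delta> k) \<le> H * \<sigma> k"
proof -
  have "f (x k + t *\<^sub>R \<delta> k) \<le> f (x k)"
    using F_decreasing[of k] by (intro f_segment_le assms) (simp add: F_def x_Suc)
  then have "sqrt (f (x k + t *\<^sub>R \<delta> k) - f xstar) \<le> \<sigma> k" by (simp add: \<sigma>_def F_def)
  then show ?thesis using zeta_le H_nonneg mult_left_mono order_trans by blast
qed

text \<open>The whole step lies in a sublevel set, where the Hessian is between
  \<open>A / ?C\<close> and \<open>?C * A\<close>. Replacing \<open>A (\<delta> k)\<close> by the
  true \<open>\<gamma> k\<close> therefore costs at most \<open>?C - 1\<close> in the quotient and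
  \<open>ln ?C\<close> in the logarithm, each at most \<open>H * \<sigma> k\<close>.\<close>

lemma q_le_psi_step: "q k \<le> psi A (G k) - psi A (G (Suc k)) + 2 * (H * \<sigma> k)"
proof -
  let ?C = "1 + H * \<sigma> k" and ?y = "grad (x k) (d k)" and ?e = "\<gamma> k (\<delta> k)"
  have C: "?C \<ge> 1" using H_nonneg sigma_nonneg by simp
  have seg: "1 + \<zeta> (x k + \<xi> *\<^sub>R \<delta> k) \<le> ?C" if "0 < \<xi>" "\<xi> < 1" for \<xi>
    using zeta_segment[of \<xi> k] that by simp
  have "\<gamma> k (inv (blinfun_apply A) (\<gamma> k)) \<le> ?C * ?e"
    unfolding \<gamma>_def x_Suc
  proof (rule cocoercive[OF spd_A])
    fix \<xi> :: real and w assume "0 < \<xi>" "\<xi> < 1"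
    show "hess (x k + \<xi> *\<^sub>R \<delta> k) w w \<le> ?C * A w w"
      using hess_xstar_comparison(1)[of "x k + \<xi> *\<^sub>R \<delta> k" w]
        mult_right_mono[OF seg[OF \<open>0 < \<xi>\<close> \<open>\<xi> < 1\<close>] spd_nonneg[OF spd_A]] by (rule order_trans)
  qed (use C in simp)
  then have 1: "\<gamma> k (inv (blinfun_apply A) (\<gamma> k)) / ?e \<le> ?C"
    using gamma_delta_pos[of k] by (simp add: pos_divide_le_eq)
  obtain \<xi> where \<xi>: "0 < \<xi>" "\<xi> < 1" "?e = hess (x k + \<xi> *\<^sub>R \<delta> k) (\<delta> k) (\<delta> k)"
    unfolding \<gamma>_def x_Suc by (rule grad_mean_value)
  have "A (\<delta> k) (\<delta> k) \<le> ?C * ?e"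
    using hess_xstar_comparison(2)[of "\<delta> k" "x k + \<xi> *\<^sub>R \<delta> k"] unfolding \<xi>(3)
    using mult_right_mono[OF seg[OF \<xi>(1,2)] spd_nonneg[OF spd_hess]] by (rule order_trans)
  moreover have "A (\<delta> k) (\<delta> k) = (h k)\<^sup>2 * A (d k) (d k)"
    by (simp add: delta_eq blinfun.minus_left blinfun.minus_right blinfun.scaleR_left
        blinfun.scaleR_right power2_eq_square)
  ultimately have "(h k)\<^sup>2 * (?y / b k) \<le> ?C * ?e"
    using grad_d_pos[of k] A_d_pos[of k] by (simp add: b_def)
  then have "(h k)\<^sup>2 * ?y \<le> ?e * (b k * ?C)"
    using b_pos[of k] by (simp add: pos_divide_le_eq mult_ac)
  moreover have "1 / s \<le> e / z" if "s > 0" "z > 0" "z \<le> e * s" for s z e :: real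
    using that by (simp add: field_simps)
  ultimately have "1 / (b k * ?C) \<le> ?e / ((h k)\<^sup>2 * ?y)"
    using b_pos[of k] C grad_d_pos[of k] h_pos[of k] by simp
  then have "ln (1 / (b k * ?C)) \<le> ln (?e / ((h k)\<^sup>2 * ?y))"
    using b_pos[of k] C by (intro ln_mono) auto
  moreover have "ln (1 / (b k * ?C)) = - ln (b k) - ln ?C"
    using b_pos[of k] C by (simp add: ln_div ln_mult)
  moreover have "ln ?C \<le> H * \<sigma> k"
    using H_nonneg sigma_nonneg[of k] by (intro ln_add_one_self_le_self) simp
  ultimately have 2: "- ln (b k) - H * \<sigma> k \<le> ln (?e / ((h k)\<^sup>2 * ?y))" by linarith
  have 3: "grad (x k) (inv (blinfun_apply A) (grad (x k))) / ?y = a k"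
    by (simp add: a_def dual_norm_square[OF spd_A])
  show ?thesis
    unfolding psi_step[OF spd_A] 3 q_def using 1 2 by linarith
qed

lemma sum_q_le: "(\<Sum>i<k. q i) \<le> psi A (\<mu>0 *\<^sub>R B) + 2 * (H * (\<Sum>i<k. \<sigma> i))"
proof -
  have "(\<Sum>i<k. q i) \<le> (\<Sum>i<k. psi A (G i) - psi A (G (Suc i)) + 2 * (H * \<sigma> i))"
    by (intro sum_mono q_le_psi_step)
  also have "\<dots> = psi A (G 0) - psi A (G k) + 2 * (H * (\<Sum>i<k. \<sigma> i))"
    using sum_lessThan_telescope'[of "\<lambda>i. psi A (G i)" k] by (simp add: sum.distrib sum_distrib_left)
  also have "\<dots> \<le> psi A (\<mu>0 *\<^sub>R B) + 2 * (H * (\<Sum>i<k. \<sigma> i))"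
    using psi_nonneg[OF spd_A spd_G] by simp
  finally show ?thesis .
qed

text \<open>With \<open>T = |g - A d|\<^sup>2 / |g|\<^sup>2\<close> in the dual norm of \<open>A\<close>, one has \<open>T = 1 - 2/a + 1/(a b)\<close>, so small \<open>q\<close>
  makes \<open>d\<close> close to the Newton direction.\<close>

lemma newton_distance:
  assumes "H * \<sigma> k \<le> 0.06" "0.55 \<le> b k"
  obtains \<theta> where "0 \<le> \<theta>" "\<theta> \<le> 1" "\<theta>\<^sup>2 \<le> 8 * q k"
    "pnorm A (x k - d k - xstar) \<le> (0.06 + 1.06 * \<theta>) * r k"
proof
  let ?u = "x k - xstar" and ?g = "grad (x k)"
  let ?T = "1 - 2 / a k + 1 / (a k * b k)"
  have a: "a k > 0" using b_le_a[of k] b_pos[of k] by linarith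
  have y: "?g (d k) = b k * A (d k) (d k)" using A_d_pos[of k] by (simp add: b_def)
  have n: "(dual_norm A ?g)\<^sup>2 = a k * b k * A (d k) (d k)"
    using grad_d_pos[of k] unfolding mult.assoc y[symmetric] a_def by simp
  have "(dual_norm A (?g - A (d k)))\<^sup>2 = (dual_norm A ?g)\<^sup>2 - 2 * ?g (d k) + A (d k) (d k)"
    using spd_inv_sym[OF spd_A, of "A (d k)" ?g]
    by (simp add: dual_norm_square[OF spd_A] linear_diff[OF linear_spd_inv[OF spd_A]] spd_inv_left[OF spd_A]
        blinfun.diff_left blinfun.diff_right)
  also have "\<dots> = ?T * (dual_norm A ?g)\<^sup>2"
    unfolding n y using a b_pos[of k] by (simp add: field_simps)
  finally have res: "(dual_norm A (?g - A (d k)))\<^sup>2 = ?T * (dual_norm A ?g)\<^sup>2" .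
  have T0: "0 \<le> ?T"
  proof -
    have "0 < (dual_norm A ?g)\<^sup>2" unfolding n using a b_pos[of k] A_d_pos[of k] by simp
    then show ?thesis using res by (metis zero_le_power2 zero_le_mult_iff not_le)
  qed
  have T1: "?T \<le> 1" using a assms(2) by (simp add: field_simps)
  let ?\<theta> = "sqrt ?T"
  show "0 \<le> ?\<theta>" "?\<theta> \<le> 1" using T0 T1 by auto
  show "?\<theta>\<^sup>2 \<le> 8 * q k"
    using T0 newton_residual_le[OF assms(2) b_le_a] by (simp add: q_def)
  have z: "\<zeta> (x k) * r k \<le> 0.06 * r k"
    using zeta_x_le[of k] assms(1) r_nonneg by (intro mult_right_mono) auto
  have lin: "dual_norm A (?g - A ?u) \<le> 0.06 * r k"
    using grad_linearization[of "x k"] z by (simp add: r_def)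
  have "dual_norm A ?g \<le> dual_norm A (?g - A ?u) + dual_norm A (A ?u)"
    using dual_norm_triangle[OF spd_A, of "?g - A ?u" "A ?u"] by simp
  then have g: "dual_norm A ?g \<le> 1.06 * r k"
    using lin by (simp add: dual_norm_apply[OF spd_A] r_def)
  have "dual_norm A (?g - A (d k)) = ?\<theta> * dual_norm A ?g"
  proof (rule power2_eq_imp_eq)
    show "(dual_norm A (?g - A (d k)))\<^sup>2 = (?\<theta> * dual_norm A ?g)\<^sup>2"
      by (simp only: power_mult_distrib real_sqrt_pow2[OF T0] res)
  qed (use T0 dual_norm_nonneg[OF spd_A] in auto)
  also have "\<dots> \<le> ?\<theta> * (1.06 * r k)" using g T0 by (intro mult_left_mono) auto
  finally have gd: "dual_norm A (?g - A (d k)) \<le> ?\<theta> * (1.06 * r k)" .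
  \<comment> \<open>The error after a unit step is the linearization error of the gradient plus the
    defect of the Newton equation for \<open>A\<close>. The 1.06 comes from bounding the gradient by
    1 + 0.06 times \<open>r k\<close>.\<close>
  have "pnorm A (x k - d k - xstar) = dual_norm A ((- 1) *\<^sub>R (?g - A ?u) + (?g - A (d k)))"
    using dual_norm_apply[OF spd_A, of "x k - d k - xstar", symmetric]
    by (simp add: blinfun.diff_right blinfun.add_right algebra_simps)
  also have "\<dots> \<le> dual_norm A (?g - A ?u) + dual_norm A (?g - A (d k))"
    using dual_norm_triangle[OF spd_A, of "(- 1) *\<^sub>R (?g - A ?u)" "?g - A (d k)"]
    unfolding dual_norm_scaleR[OF spd_A] by simp
  also have "\<dots> \<le> (0.06 + 1.06 * ?\<theta>) * r k" using lin gd by (simp add: algebra_simps)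
  finally show "pnorm A (x k - d k - xstar) \<le> (0.06 + 1.06 * ?\<theta>) * r k" .
qed

text \<open>Were the Hessian constantly \<open>A\<close>, the unit step would pass the Armijo test
  exactly if \<open>b k \<ge> 1 / (2 * (1 - \<eta>))\<close>, and this threshold is 1 minus the
  fraction below. Taking 0.9 of the fraction raises it just enough to admit Hessians up to
  \<open>(1 + 0.1 * (1 - 2 * \<eta>)) * A\<close>.\<close>

definition tbar :: real where "tbar = 0.9 * ((1 - 2 * \<eta>) / (2 * (1 - \<eta>)))"

lemma tbar_bounds: "0 < tbar" "tbar < 0.45"
  using eta_pos eta_less by (auto simp: tbar_def field_simps)

lemma unit_step_accepted:
  assumes close: "H * \<sigma> k \<le> 0.06 * (1 - 2 * \<eta>)" and b: "1 - tbar \<le> b k"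
  shows "h k = 1"
proof (rule unit_step)
  let ?u = "x k - xstar" and ?v = "x k - d k - xstar"
  define m where "m = 1 - 2 * \<eta>"
  have m: "0 < m" "m < 1" using eta_pos eta_less by (auto simp: m_def)
  have c6: "H * \<sigma> k \<le> 0.06" using close m by (simp add: m_def)
  have b55: "0.55 \<le> b k" using b tbar_bounds by simp
  obtain \<theta> where \<theta>: "0 \<le> \<theta>" "\<theta> \<le> 1" "pnorm A ?v \<le> (0.06 + 1.06 * \<theta>) * r k"
    using newton_distance[OF c6 b55] by blast
  have "(0.06 + 1.06 * \<theta>) * r k \<le> 1.12 * r k"
    using \<theta> r_nonneg by (intro mult_right_mono) auto
  then have v: "pnorm A ?v \<le> 1.12 * r k" using \<theta> by simp
  have "(r k)\<^sup>2 \<le> 2 * F k * (1 + 0.06 / 3)"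
    using r_le_F[of k] c6 mult_left_mono[of "1 + H * \<sigma> k / 3" "1 + 0.06 / 3" "2 * F k"] F_nonneg[of k]
    by auto
  also have "\<dots> \<le> 2 * 1.0201 * F k" using F_nonneg[of k] by simp
  also have "\<dots> = (sqrt 2 * 1.01 * \<sigma> k)\<^sup>2"
    by (simp only: power_mult_distrib \<sigma>_def real_sqrt_pow2[OF F_nonneg]) (simp add: power2_eq_square)
  finally have "r k \<le> sqrt 2 * 1.01 * \<sigma> k"
    by (rule power2_le_imp_le) (simp add: sigma_nonneg)
  then have "L2 / (\<mu> * sqrt \<mu>) * r k \<le> L2 / (\<mu> * sqrt \<mu>) * (sqrt 2 * 1.01 * \<sigma> k)"
    using L2_nonneg mu_pos by (intro mult_left_mono) auto
  also have "\<dots> = 1.01 * (H * \<sigma> k)" by (simp add: H_eq mult_ac)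
  also have "\<dots> \<le> 1.01 * (0.06 * m)" using close by (simp add: m_def)
  finally have rk: "L2 / (\<mu> * sqrt \<mu>) * r k \<le> 1.01 * (0.06 * m)" .
  \<comment> \<open>\<open>zeta_segment\<close> is of no help, since the trial step is not yet known
    to decrease \<open>f\<close>. Instead both ends lie within 1.12 \<open>r k\<close> of
    \<open>xstar\<close>, where 1.12 = 0.06 + 1.06, and 1.12 * 1.01 * 0.06 is below 0.1; here 1.01
    bounds the square root of 1 + 0.06/3.\<close>
  have seg: "\<zeta> (x k + \<xi> *\<^sub>R (- d k)) \<le> 0.1 * m" if \<xi>: "0 \<le> \<xi>" "\<xi> \<le> 1" for \<xi>
  proof -
    have "pnorm A (x k + \<xi> *\<^sub>R (- d k) - xstar) = pnorm A ((1 - \<xi>) *\<^sub>R ?u + \<xi> *\<^sub>R ?v)"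
      by (simp add: algebra_simps)
    also have "\<dots> \<le> (1 - \<xi>) * r k + \<xi> * pnorm A ?v"
      using pnorm_triangle[OF spd_A, of "(1 - \<xi>) *\<^sub>R ?u" "\<xi> *\<^sub>R ?v"] \<xi>
      by (simp add: pnorm_scaleR[OF spd_A] r_def)
    also have "\<dots> \<le> (1 - \<xi>) * (1.12 * r k) + \<xi> * (1.12 * r k)"
      using \<xi> v r_nonneg[of k] by (intro add_mono mult_left_mono) auto
    also have "\<dots> = 1.12 * r k" by (simp only: distrib_right[symmetric]) simp
    finally have "L2 / (\<mu> * sqrt \<mu>) * pnorm A (x k + \<xi> *\<^sub>R (- d k) - xstar) \<le> L2 / (\<mu> * sqrt \<mu>) * (1.12 * r k)"
      using L2_nonneg mu_pos by (intro mult_left_mono) auto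
    then show ?thesis
      using zeta_le_pnorm[of "x k + \<xi> *\<^sub>R (- d k)"] rk m by simp
  qed
  have "hess (x k + \<xi> *\<^sub>R (- d k)) (- d k) (- d k) \<le> (1 + 0.1 * m) * A (d k) (d k) + 0 * \<xi>"
    if \<xi>: "0 \<le> \<xi>" "\<xi> \<le> 1" for \<xi>
  proof -
    have "hess (x k + \<xi> *\<^sub>R (- d k)) (- d k) (- d k) \<le> (1 + \<zeta> (x k + \<xi> *\<^sub>R (- d k))) * A (d k) (d k)"
      using hess_xstar_comparison(1)[of "x k + \<xi> *\<^sub>R (- d k)" "d k"]
      by (simp add: blinfun.minus_left blinfun.minus_right)
    also have "\<dots> \<le> (1 + 0.1 * m) * A (d k) (d k)"
      using seg[OF \<xi>] A_d_pos[of k] by (intro mult_right_mono) auto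
    finally show ?thesis by simp
  qed
  from second_order_upper_bound[OF DERIV_f_line[of "x k" "- d k"] DERIV_grad_line[of "x k" "- d k" "- d k"] this]
  have taylor: "f (x k - d k) \<le> f (x k) - grad (x k) (d k) + (1 + 0.1 * m) / 2 * A (d k) (d k)"
    by (simp add: blinfun.minus_right)
  have "(1 + 0.1 * m) / 2 = (1 - \<eta>) * (1 - tbar)"
    using eta_less by (simp add: m_def tbar_def field_simps)
  also have "\<dots> \<le> (1 - \<eta>) * b k" using b eta_less by (intro mult_left_mono) auto
  finally have "(1 + 0.1 * m) / 2 * A (d k) (d k) \<le> (1 - \<eta>) * b k * A (d k) (d k)"
    using A_d_pos[of k] by (intro mult_right_mono) auto
  also have "\<dots> = (1 - \<eta>) * grad (x k) (d k)" using A_d_pos[of k] by (simp add: b_def)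
  finally show "\<eta> * grad (x k) (d k) \<le> f (x k) - f (x k - d k)"
    using taylor by (simp add: algebra_simps)
qed

lemma omega_star_tbar: "0 < omega_star tbar" "omega_star tbar \<le> 0.15"
proof -
  have "0 \<le> tbar" "tbar < 1" using tbar_bounds by simp_all
  from neg_ln_one_minus_lower[OF this] show "0 < omega_star tbar"
    using zero_less_power[OF tbar_bounds(1), of 2] unfolding omega_star_def by linarith
  have "omega_star tbar \<le> 0.55 - 1 - ln 0.55"
    using diff_ln_antimono[of "0.55" "1 - tbar"] tbar_bounds eta_pos by (simp add: omega_star_def)
  \<comment> \<open>Five terms of the series of \<open>exp 0.6\<close> already exceed 1/0.55. The
    resulting 0.15 is what later makes \<open>Y \<ge> 6.66\<close>.\<close>
  moreover have "- 0.6 \<le> ln (0.55 :: real)"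
  proof -
    have "(\<Sum>k<5. (0.6::real) ^ k /\<^sub>R fact k) \<le> exp 0.6"
      unfolding exp_def by (intro sum_le_suminf summable_exp_generic) auto
    then have "1 / 0.55 \<le> exp (0.6 :: real)" by (simp add: eval_nat_numeral fact_numeral)
    then have "exp (- 0.6) \<le> (0.55 :: real)" by (simp add: exp_minus field_simps)
    then show ?thesis by (simp add: ln_ge_iff)
  qed
  ultimately show "omega_star tbar \<le> 0.15" by simp
qed

text \<open>The two demands on \<open>M\<close> belong to the two cases. With a unit step, 20 is the
  coefficient of \<open>superlinear_factor_le\<close>. Otherwise \<open>q k\<close> is at least
  \<open>omega_star tbar\<close>, so \<open>M * q k \<ge> 1.02\<close> outweighs the -1 and the
  growth factor 1.02, which is at most \<open>exp 0.02\<close>.\<close>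

lemma r_step:
  assumes close: "H * \<sigma> k \<le> 0.06 * (1 - 2 * \<eta>)"
    and M: "20 \<le> M" "1.02 / omega_star tbar \<le> M"
  shows "r (Suc k) \<le> exp (- 1 + M * q k) * r k"
proof (cases "1 - tbar \<le> b k")
  case True
  have c6: "H * \<sigma> k \<le> 0.06" using close eta_pos by simp
  have b: "0.55 \<le> b k" using True tbar_bounds by simp
  obtain \<theta> where \<theta>: "\<theta>\<^sup>2 \<le> 8 * q k" "pnorm A (x k - d k - xstar) \<le> (0.06 + 1.06 * \<theta>) * r k"
    using newton_distance[OF c6 b] by blast
  have "r (Suc k) = pnorm A (x k - d k - xstar)"
    using unit_step_accepted[OF close True] by (simp add: r_def x_Suc delta_eq)
  also have "\<dots> \<le> (0.06 + 1.06 * \<theta>) * r k" by (rule \<theta>)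
  also have "\<dots> \<le> exp (- 1 + 20 * q k) * r k"
    by (intro mult_right_mono superlinear_factor_le \<theta> r_nonneg)
  also have "\<dots> \<le> exp (- 1 + M * q k) * r k"
    using M q_nonneg[of k] by (intro mult_right_mono r_nonneg) (simp add: mult_right_mono)
  finally show ?thesis .
next
  case False
  have "omega_star tbar \<le> b k - 1 - ln (b k)"
    using diff_ln_antimono[of "b k" "1 - tbar"] b_pos[of k] False tbar_bounds by (simp add: omega_star_def)
  then have "omega_star tbar \<le> q k" using q_ge[of k] by linarith
  then have "1.02 / omega_star tbar * omega_star tbar \<le> M * q k"
    using M omega_star_tbar by (intro mult_mono) auto
  then have Mq: "1.02 \<le> M * q k" using omega_star_tbar by simp
  have "r (Suc k) \<le> (1 + 0.06 / 3) * r k"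
    using r_growth[of k "0.06"] close eta_pos by simp
  also have "\<dots> \<le> exp 0.02 * r k"
    using exp_ge_add_one_self[of "0.02"] by (intro mult_right_mono r_nonneg) simp
  also have "\<dots> \<le> exp (- 1 + M * q k) * r k"
    using Mq by (intro mult_right_mono r_nonneg) simp
  finally show ?thesis .
qed

lemma superlinear_convergence:
  assumes close: "\<And>k. K \<le> k \<Longrightarrow> H * \<sigma> k \<le> 0.06 * (1 - 2 * \<eta>)"
    and \<Omega>: "\<And>k. (\<Sum>i<k. q i) \<le> \<Omega>"
    and k: "7 * (1 / omega_star tbar + 3.02) * \<Omega> \<le> real k"
  shows "r (K + k) \<le> (1 / 2) ^ k * r K"
proof -
  define M where "M = max 20 (1.02 / omega_star tbar)"
  have \<Omega>0: "0 \<le> \<Omega>" using \<Omega>[of 0] by simp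
  have M0: "0 \<le> M" by (simp add: M_def)
  have step: "r (K + j) \<le> exp (- real j + M * (\<Sum>i\<in>{K..<K + j}. q i)) * r K" for j
  proof (induction j)
    case (Suc j)
    have "r (K + Suc j) \<le> exp (- 1 + M * q (K + j)) * r (K + j)"
      using r_step[OF close, of "K + j" M] by (simp add: M_def)
    also have "\<dots> \<le> exp (- 1 + M * q (K + j)) * (exp (- real j + M * (\<Sum>i\<in>{K..<K + j}. q i)) * r K)"
      using Suc by (intro mult_left_mono) auto
    also have "\<dots> = exp ((- 1 + M * q (K + j)) + (- real j + M * (\<Sum>i\<in>{K..<K + j}. q i))) * r K"
      by (simp only: exp_add mult.assoc)
    also have "(- 1 + M * q (K + j)) + (- real j + M * (\<Sum>i\<in>{K..<K + j}. q i))
      = - real (Suc j) + M * (\<Sum>i\<in>{K..<K + Suc j}. q i)"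
      by (simp add: algebra_simps)
    finally show ?case .
  qed simp
  have "(\<Sum>i\<in>{K..<K + k}. q i) \<le> (\<Sum>i<K + k. q i)"
    by (intro sum_mono2) (auto simp: q_nonneg)
  then have sum: "M * (\<Sum>i\<in>{K..<K + k}. q i) \<le> M * \<Omega>"
    using \<Omega>[of "K + k"] M0 by (intro mult_left_mono) auto
  define Y where "Y = 1 / omega_star tbar"
  have Y: "Y \<ge> 6.66"
    using omega_star_tbar by (simp add: Y_def field_simps)
  \<comment> \<open>11/36 is 1 - 25/36, a lower bound of \<open>1 - ln 2\<close>. The term 3.02
    lifts the right side above 20 even for the smallest \<open>Y\<close>; the coefficient 77/36 of
    \<open>Y\<close> exceeds 1.02.\<close>
  have "M \<le> 11 / 36 * (7 * (Y + 3.02))"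
  proof -
    have "1.02 / omega_star tbar = 1.02 * Y" by (simp add: Y_def)
    then show ?thesis unfolding M_def using Y by simp
  qed
  then have "M * \<Omega> \<le> 11 / 36 * (7 * (Y + 3.02)) * \<Omega>" using \<Omega>0 by (rule mult_right_mono)
  also have "\<dots> = 11 / 36 * (7 * (Y + 3.02) * \<Omega>)" by (simp only: mult.assoc)
  also have "\<dots> \<le> 11 / 36 * real k" using k unfolding Y_def by (rule mult_left_mono) simp
  also have "\<dots> \<le> (1 - ln 2) * real k"
    using ln2_le_25_over_36 by (intro mult_right_mono) auto
  finally have "- real k + M * (\<Sum>i\<in>{K..<K + k}. q i) \<le> real k * ln (1 / 2)"
    using sum by (simp add: ln_div algebra_simps)
  then have "exp (- real k + M * (\<Sum>i\<in>{K..<K + k}. q i)) \<le> exp (real k * ln (1 / 2))" by simp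
  also have "\<dots> = (1 / 2) ^ k" by (simp add: exp_of_nat_mult)
  finally show ?thesis
    using step[of k] r_nonneg[of K] by (meson mult_right_mono order_trans)
qed

end

subsection \<open>Iteration counts\<close>

context bfgs_run
begin

definition \<Delta> :: real where "\<Delta> = 0.06 * (1 - 2 * \<eta>)"

text \<open>The first count before rounding. Half of it is the number of iterations that
  \<open>F_global_bound\<close> asks for to reach the region.\<close>

definition K_real :: real where
  "K_real = 2 / \<eta> * \<kappa>\<^sup>2 * ln (H\<^sup>2 * F 0 / \<Delta>\<^sup>2) + 2 * real DIM('a) * ln \<kappa>"

lemma Delta_bounds: "0 < \<Delta>" "\<Delta> < 0.06"
  using eta_pos eta_less by (auto simp: \<Delta>_def)

lemma H_pos: "L2 > 0 \<Longrightarrow> H > 0"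
  using mu_pos by (simp add: H_def)

lemma rate_bounds: "0 < \<eta> / \<kappa>\<^sup>2" "\<eta> / \<kappa>\<^sup>2 \<le> 1"
proof -
  have "1 \<le> \<kappa>\<^sup>2" using kappa_ge_1 by simp
  moreover from this have "0 < \<kappa>\<^sup>2" by linarith
  ultimately show "0 < \<eta> / \<kappa>\<^sup>2" "\<eta> / \<kappa>\<^sup>2 \<le> 1"
    using eta_pos eta_less by (simp_all add: pos_divide_le_eq)
qed

lemma K_real_eq:
  "ln (H\<^sup>2 * F 0 / \<Delta>\<^sup>2) = \<eta> / \<kappa>\<^sup>2 * (K_real / 2 - real DIM('a) * ln \<kappa>)"
  using eta_pos kappa_ge_1 by (simp add: K_real_def field_simps)

lemma ln_gap_le:
  assumes "L2 > 0"
  shows "ln (H\<^sup>2 * F k / \<Delta>\<^sup>2) \<le> \<eta> / \<kappa>\<^sup>2 * (K_real / 2 - real k)"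
proof -
  let ?e = "\<eta> / \<kappa>\<^sup>2 * (real k - real DIM('a) * ln \<kappa>)"
  have H: "0 < H\<^sup>2 / \<Delta>\<^sup>2" using H_pos[OF assms] Delta_bounds by simp
  have "H\<^sup>2 / \<Delta>\<^sup>2 * F k \<le> H\<^sup>2 / \<Delta>\<^sup>2 * (exp (- ?e) * F 0)"
    by (intro mult_left_mono F_global_bound less_imp_le[OF H])
  then have "ln (H\<^sup>2 / \<Delta>\<^sup>2 * F k) \<le> ln (H\<^sup>2 / \<Delta>\<^sup>2 * (exp (- ?e) * F 0))"
    using H F_pos[of k] by (intro ln_mono mult_pos_pos)
  also have "H\<^sup>2 / \<Delta>\<^sup>2 * (exp (- ?e) * F 0) = exp (- ?e) * (H\<^sup>2 * F 0 / \<Delta>\<^sup>2)" by simp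
  also have "ln \<dots> = - ?e + ln (H\<^sup>2 * F 0 / \<Delta>\<^sup>2)"
    using H_pos[OF assms] Delta_bounds F_pos[of 0] by (subst ln_mult_pos) auto
  finally show ?thesis unfolding K_real_eq by (simp add: algebra_simps)
qed

lemma gap_le_region:
  assumes "L2 > 0" "K_real \<le> real K" "K \<le> k"
  shows "H\<^sup>2 * F k \<le> \<Delta>\<^sup>2"
proof -
  have pos: "0 < H\<^sup>2 * F k / \<Delta>\<^sup>2" for k
    using H_pos[OF assms(1)] Delta_bounds F_pos[of k] by simp
  have "ln (H\<^sup>2 * F k / \<Delta>\<^sup>2) \<le> 0"
  \<comment> \<open>If the start is already in the region, \<open>K_real\<close> may be negative,
    and half of it then exceeds it; monotonicity of \<open>F\<close> settles this case.\<close>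
  proof (cases "ln (H\<^sup>2 * F 0 / \<Delta>\<^sup>2) \<le> 0")
    case True
    have "H\<^sup>2 * F k / \<Delta>\<^sup>2 \<le> H\<^sup>2 * F 0 / \<Delta>\<^sup>2"
      using F_antimono[of 0 k] by (intro divide_right_mono mult_left_mono) auto
    then have "ln (H\<^sup>2 * F k / \<Delta>\<^sup>2) \<le> ln (H\<^sup>2 * F 0 / \<Delta>\<^sup>2)" using pos by (intro ln_mono) auto
    then show ?thesis using True by linarith
  next
    case False
    have "0 \<le> real DIM('a) * ln \<kappa>" using kappa_ge_1 by simp
    moreover have "0 < K_real / 2 - real DIM('a) * ln \<kappa>"
      using False rate_bounds(1) unfolding K_real_eq not_le by (rule zero_less_mult_pos)
    ultimately have "K_real / 2 - real k \<le> 0" using assms by linarith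
    then have "\<eta> / \<kappa>\<^sup>2 * (K_real / 2 - real k) \<le> 0"
      using rate_bounds(1) by (intro mult_nonneg_nonpos) auto
    then show ?thesis using ln_gap_le[OF assms(1), of k] by linarith
  qed
  then show ?thesis using pos[of k] Delta_bounds by (simp add: divide_le_eq)
qed

text \<open>For a negative third count, where \<open>k\<close> may precede \<open>K\<close>. The
  base 4 matches the factor 1/2 before the binary logarithm in that count.\<close>

lemma gap_le_before_region:
  assumes "L2 > 0" "K_real \<le> real K"
  shows "H\<^sup>2 * F k \<le> \<Delta>\<^sup>2 * 4 ^ (K - k)"
proof (cases "K \<le> k")
  case True
  then show ?thesis using gap_le_region[OF assms] by simp
next
  case False
  have pos: "0 < H\<^sup>2 * F k / \<Delta>\<^sup>2"
    using H_pos[OF assms(1)] Delta_bounds F_pos[of k] by simp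
  have "ln (H\<^sup>2 * F k / \<Delta>\<^sup>2) \<le> \<eta> / \<kappa>\<^sup>2 * (K_real / 2 - real k)" by (rule ln_gap_le[OF assms(1)])
  also have "\<dots> \<le> \<eta> / \<kappa>\<^sup>2 * real (K - k)"
    using rate_bounds(1) assms(2) False by (intro mult_left_mono) (auto simp: of_nat_diff)
  also have "\<dots> \<le> 1 * real (K - k)" using rate_bounds(2) by (intro mult_right_mono) auto
  also have "\<dots> \<le> real (K - k) * ln 4"
  proof -
    have "ln (exp 1) \<le> ln (4 :: real)" using e_less_272 by (intro ln_mono) auto
    then have "real (K - k) * 1 \<le> real (K - k) * ln 4" by (intro mult_left_mono) auto
    then show ?thesis by simp
  qed
  also have "\<dots> = ln (4 ^ (K - k))" by (simp add: ln_realpow)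
  finally have "H\<^sup>2 * F k / \<Delta>\<^sup>2 \<le> 4 ^ (K - k)" using pos by (subst (asm) ln_le_cancel_iff) auto
  then show ?thesis using Delta_bounds by (simp add: pos_divide_le_eq mult.commute)
qed

lemma H_sigma_le:
  assumes "L2 > 0 \<Longrightarrow> K_real \<le> real K" "K \<le> k"
  shows "H * \<sigma> k \<le> \<Delta>"
proof (cases "L2 = 0")
  case True
  have "H = sqrt 2 * L2 / \<mu> powr (3 / 2)" by (rule H_def)
  also have "\<dots> = 0" using True by simp
  finally show ?thesis using Delta_bounds by simp
next
  case False
  then have L2: "L2 > 0" using L2_nonneg by simp
  show ?thesis
  proof (rule power2_le_imp_le)
    have "(H * \<sigma> k)\<^sup>2 = H\<^sup>2 * F k"
      by (simp only: power_mult_distrib \<sigma>_def real_sqrt_pow2[OF F_nonneg])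
    then show "(H * \<sigma> k)\<^sup>2 \<le> \<Delta>\<^sup>2" using gap_le_region[OF L2 assms(1)[OF L2] assms(2)] by simp
  qed (use Delta_bounds in simp)
qed

lemma gap_le_epsilon:
  fixes K0 K1 k :: nat
  assumes L2: "L2 > 0" and K: "K_real \<le> real K0" and \<epsilon>: "\<epsilon> > 0"
    and superlinear: "\<And>j. K1 \<le> j \<Longrightarrow> r (K0 + j) \<le> (1 / 2) ^ j * r K0"
    and k: "real K0 + real K1 + 1 / 2 * log 2 ((1 + 1 / 3 * \<Delta>)\<^sup>2 * \<Delta>\<^sup>2 / (H\<^sup>2 * \<epsilon>)) \<le> real k"
  shows "F k \<le> \<epsilon>"
proof -
  define D where "D = 1 + 1 / 3 * \<Delta>"
  define Q where "Q = D\<^sup>2 * \<Delta>\<^sup>2 / (H\<^sup>2 * \<epsilon>)"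
  note H = H_pos[OF L2]
  have D: "1 \<le> D" using Delta_bounds by (simp add: D_def)
  have Q: "0 < Q" using H \<epsilon> D Delta_bounds by (simp add: Q_def)
  have Qe: "Q * (H\<^sup>2 * \<epsilon>) = D\<^sup>2 * \<Delta>\<^sup>2" using H \<epsilon> by (simp add: Q_def)
  have k': "real K0 + real K1 + 1 / 2 * log 2 Q \<le> real k"
    using k by (simp only: Q_def D_def)
  have "H\<^sup>2 * F k \<le> H\<^sup>2 * \<epsilon>"
  proof (cases "K0 + K1 \<le> k")
    case True
    define m where "m = k - K0"
    have m: "k = K0 + m" "K1 \<le> m" using True by (auto simp: m_def)
    have "log 2 Q \<le> 2 * real m" using k' m by simp
    then have "Q \<le> 2 powr (2 * real m)" using Q by (simp add: log_le_iff)
    \<comment> \<open>Halving \<open>r\<close> quarters the gap; the two conversions between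
      \<open>r^2\<close> and \<open>2 * F\<close>, at \<open>K0\<close> and at \<open>k\<close>,
      cost the factor \<open>D^2\<close>.\<close>
    also have "\<dots> = 4 ^ m" by (simp add: powr_powr[symmetric] powr_realpow)
    finally have Qm: "Q \<le> 4 ^ m" .
    have close: "H * \<sigma> j \<le> \<Delta>" if "K0 \<le> j" for j using H_sigma_le that K by blast
    have "2 * F k \<le> (r k)\<^sup>2 * (1 + H * \<sigma> k / 3)" by (rule F_le_r)
    also have "\<dots> \<le> (r k)\<^sup>2 * D" using close[of k] m by (intro mult_left_mono) (auto simp: D_def)
    also have "\<dots> \<le> ((1 / 2) ^ m * r K0)\<^sup>2 * D"
      using superlinear[OF m(2)] r_nonneg[of k] D by (intro mult_right_mono power_mono) (auto simp: m)
    also have "\<dots> = (1 / 4) ^ m * D * (r K0)\<^sup>2"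
      by (simp add: power_mult_distrib flip: power_mult) (simp add: power_mult mult.commute[of m] power2_eq_square)
    also have "\<dots> \<le> (1 / 4) ^ m * D * (2 * F K0 * (1 + H * \<sigma> K0 / 3))"
      using D by (intro mult_left_mono r_le_F) auto
    also have "\<dots> \<le> (1 / 4) ^ m * D * (2 * F K0 * D)"
      using close[of K0] D F_nonneg[of K0] by (intro mult_left_mono) (auto simp: D_def)
    finally have "F k \<le> (1 / 4) ^ m * D\<^sup>2 * F K0" by (simp add: power2_eq_square mult_ac)
    then have "H\<^sup>2 * F k \<le> H\<^sup>2 * ((1 / 4) ^ m * D\<^sup>2 * F K0)" by (intro mult_left_mono) auto
    also have "\<dots> = (1 / 4) ^ m * D\<^sup>2 * (H\<^sup>2 * F K0)" by (simp add: mult_ac)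
    also have "\<dots> \<le> (1 / 4) ^ m * D\<^sup>2 * \<Delta>\<^sup>2"
      using gap_le_region[OF L2 K order_refl] by (intro mult_left_mono) auto
    also have "\<dots> = (1 / 4) ^ m * (Q * (H\<^sup>2 * \<epsilon>))" by (simp add: Qe)
    also have "\<dots> \<le> (1 / 4) ^ m * (4 ^ m * (H\<^sup>2 * \<epsilon>))"
      using Qm \<epsilon> by (intro mult_left_mono mult_right_mono) auto
    also have "\<dots> = H\<^sup>2 * \<epsilon>" by (simp add: power_one_over)
    finally show ?thesis .
  next
    case False
    \<comment> \<open>Truncated subtraction: \<open>m = 0\<close> if only the superlinear phase is
      missing. In either case \<open>Q\<close> is at most \<open>4^-m\<close>, so the required
      accuracy is no better than what the linear phase already guarantees at
      \<open>k\<close>.\<close>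
    define m where "m = K0 - k"
    have "real m \<le> real K0 + real K1 - real k" using False by (auto simp: m_def of_nat_diff)
    then have "log 2 Q \<le> - (2 * real m)" using k' by simp
    then have "Q \<le> 2 powr (- (2 * real m))" using Q by (simp add: log_le_iff)
    also have "\<dots> = 1 / 4 ^ m" by (simp add: powr_minus_divide powr_powr[symmetric] powr_realpow)
    finally have Qm: "Q * 4 ^ m \<le> 1" by (simp add: field_simps)
    have "H\<^sup>2 * F k \<le> 1 * (\<Delta>\<^sup>2 * 4 ^ m)" using gap_le_before_region[OF L2 K, of k] by (simp add: m_def)
    also have "\<dots> \<le> D\<^sup>2 * (\<Delta>\<^sup>2 * 4 ^ m)" using D by (intro mult_right_mono) auto
    also have "\<dots> = (Q * (H\<^sup>2 * \<epsilon>)) * 4 ^ m" by (simp only: Qe mult.assoc)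
    also have "\<dots> = (Q * 4 ^ m) * (H\<^sup>2 * \<epsilon>)" by (simp add: mult_ac)
    also have "\<dots> \<le> 1 * (H\<^sup>2 * \<epsilon>)" using Qm \<epsilon> by (intro mult_right_mono) auto
    finally show ?thesis by simp
  qed
  then show ?thesis using H by simp
qed

lemma log_term_le:
  assumes "L2 > 0" "\<epsilon> > 0"
  shows "1 / 2 * log 2 ((1 + 1 / 3 * \<Delta>)\<^sup>2 * \<Delta>\<^sup>2 / (H\<^sup>2 * \<epsilon>))
    \<le> real_of_int \<lceil>1 / 2 * log 2 (0.01 / (H\<^sup>2 * \<epsilon>))\<rceil>"
proof -
  have D: "0 \<le> (1 + 1 / 3 * \<Delta>) * \<Delta>" "0 < (1 + 1 / 3 * \<Delta>) * \<Delta>" using Delta_bounds by auto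
  have "(1 + 1 / 3 * \<Delta>) * \<Delta> \<le> 1.02 * 0.06" using Delta_bounds by (intro mult_mono) auto
  then have "((1 + 1 / 3 * \<Delta>) * \<Delta>)\<^sup>2 \<le> (1.02 * 0.06)\<^sup>2" using D(1) by (rule power_mono)
  then have "(1 + 1 / 3 * \<Delta>)\<^sup>2 * \<Delta>\<^sup>2 \<le> 0.01"
    unfolding power_mult_distrib by (rule order_trans) (simp add: power2_eq_square)
  then have "(1 + 1 / 3 * \<Delta>)\<^sup>2 * \<Delta>\<^sup>2 / (H\<^sup>2 * \<epsilon>) \<le> 0.01 / (H\<^sup>2 * \<epsilon>)"
    using assms(2) by (intro divide_right_mono) auto
  moreover have "0 < (1 + 1 / 3 * \<Delta>)\<^sup>2 * \<Delta>\<^sup>2 / (H\<^sup>2 * \<epsilon>)"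
    using Delta_bounds H_pos[OF assms(1)] assms(2) by (intro divide_pos_pos mult_pos_pos zero_less_power) auto
  ultimately have "log 2 ((1 + 1 / 3 * \<Delta>)\<^sup>2 * \<Delta>\<^sup>2 / (H\<^sup>2 * \<epsilon>)) \<le> log 2 (0.01 / (H\<^sup>2 * \<epsilon>))"
    by (intro log_mono) auto
  then show ?thesis by linarith
qed

end

theorem mainTheorem6:
  fixes B :: "'a::euclidean_space \<Rightarrow>\<^sub>L 'a dual"
    and f :: "'a \<Rightarrow> real"
    and grad :: "'a \<Rightarrow> 'a dual"
    and hess :: "'a \<Rightarrow> ('a \<Rightarrow>\<^sub>L 'a dual)"
    and x :: "nat \<Rightarrow> 'a" and Hop :: "nat \<Rightarrow> 'a dual \<Rightarrow> 'a" and h :: "nat \<Rightarrow> real"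
    and xstar :: 'a
    and \<mu> L L\<^sub>2 \<mu>\<^sub>0 \<nu> \<eta>\<^sub>1 S \<epsilon> :: real
    and n :: nat
    and fstar \<kappa> H F\<^sub>0 \<Delta> \<Omega> tbar \<Upsilon> :: real and \<sigma> r :: "nat \<Rightarrow> real"
    and K0 K1 :: nat and Keps :: real
  assumes B: "self_adjoint B" "pos_def B"
    and params: "\<mu> > 0" "L > 0" "L\<^sub>2 \<ge> 0"
    and grad: "\<And>u. (f has_derivative grad u) (at u)"
    and hess: "\<And>u. (grad has_derivative hess u) (at u)"
    and strongly_convex: "\<And>u v. (grad u - grad v) (u - v) \<ge> \<mu> * (pnorm B (u - v))^2"
    and grad_Lipschitz: "\<And>u v. dual_norm B (grad u - grad v) \<le> L * pnorm B (u - v)"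
    and hess_Lipschitz: "\<And>u v. op_norm B (hess u - hess v) \<le> L\<^sub>2 * pnorm B (u - v)"
    and minimizer: "\<And>u. f xstar \<le> f u"
  defines "fstar \<equiv> f xstar"
    and "\<kappa> \<equiv> L / \<mu>"
    and "H \<equiv> sqrt 2 * L\<^sub>2 / \<mu> powr (3/2)"
    and "n \<equiv> DIM('a)"
  assumes eta: "0 < \<eta>\<^sub>1" "\<eta>\<^sub>1 < 1/2"
    and nu: "1 \<le> \<nu>" "\<nu> \<le> \<kappa>"
    and mu0: "\<mu> \<le> \<mu>\<^sub>0" "\<mu>\<^sub>0 \<le> \<nu> * \<mu>"
    and init: "Hop 0 = inv (blinfun_apply (\<mu>\<^sub>0 *\<^sub>R B))"
    and bfgs: "bfgs_iterates grad h x Hop"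
    and step: "\<And>k. backtracking f grad \<eta>\<^sub>1 (x k) (Hop k (grad (x k))) (h k)"
    and standing: "\<And>k. (grad (x (Suc k)) - grad (x k)) (x (Suc k) - x k) > 0"
  defines "\<sigma> \<equiv> \<lambda>k. sqrt (f (x k) - fstar)"
    and "F\<^sub>0 \<equiv> f (x 0) - fstar"
    and "\<Delta> \<equiv> 0.06 * (1 - 2 * \<eta>\<^sub>1)"
    and "r \<equiv> \<lambda>k. sqrt (hess xstar (x k - xstar) (x k - xstar))"
  assumes S: "\<And>k. k \<ge> 1 \<Longrightarrow> H * (\<Sum>i<k. \<sigma> i) \<le> S"
  defines "\<Omega> \<equiv> psi (hess xstar) (\<mu>\<^sub>0 *\<^sub>R B) + 2 * S"
    and "tbar \<equiv> 0.9 * ((1 - 2 * \<eta>\<^sub>1) / (2 * (1 - \<eta>\<^sub>1)))"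
    and "\<Upsilon> \<equiv> 1 / omega_star tbar"
    \<comment> \<open>iteration counts: a negative bound means that no iterations are needed;
        for \<open>L\<^sub>2 = 0\<close> the bound is \<open>ln 0 = -\<infinity>\<close>\<close>
    and "K0 \<equiv> if L\<^sub>2 = 0 then 0 else
           nat \<lceil>2 / \<eta>\<^sub>1 * \<kappa>^2 * ln (H^2 * F\<^sub>0 / (0.06 * (1 - 2 * \<eta>\<^sub>1))^2) + 2 * real n * ln \<kappa>\<rceil>"
    and "K1 \<equiv> nat \<lceil>7 * (\<Upsilon> + 3.02) * \<Omega>\<rceil>"
    and "Keps \<equiv> 1/2 * log 2 ((1 + 1/3 * \<Delta>)^2 * \<Delta>^2 / (H^2 * \<epsilon>))"
  assumes eps: "\<epsilon> > 0"
  shows "(\<forall>k\<ge>K0. H * \<sigma> k \<le> \<Delta>)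
       \<and> (\<forall>k\<ge>K1. r (K0 + k) \<le> (1/2)^k * r K0)
       \<and> (L\<^sub>2 > 0 \<longrightarrow>  \<comment> \<open>for \<open>L\<^sub>2 = 0\<close> the third count is infinite\<close>
            (\<forall>k::nat. real k \<ge> real K0 + real K1 + Keps \<longrightarrow> f (x k) - fstar \<le> \<epsilon>)
          \<and> real K0 + real K1 + Keps \<le>
              real (nat \<lceil>2 / \<eta>\<^sub>1 * \<kappa>^2 * ln (H^2 * F\<^sub>0 / (0.06 * (1 - 2 * \<eta>\<^sub>1))^2) + 2 * real n * ln \<kappa>\<rceil>)
            + real (nat \<lceil>7 * (\<Upsilon> + 3.02) * \<Omega>\<rceil>)
            + real_of_int \<lceil>1/2 * log 2 (0.01 / (H^2 * \<epsilon>))\<rceil>)"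
proof -
  have "\<nu> * \<mu> \<le> \<kappa> * \<mu>" using nu(2) params(1) by (intro mult_right_mono) auto
  then have mu0_le: "\<mu>\<^sub>0 \<le> L" using mu0(2) params(1) by (simp add: \<kappa>_def)
  interpret R: bfgs_run B f grad hess \<mu> L L\<^sub>2 xstar x Hop h \<eta>\<^sub>1 \<mu>\<^sub>0
  proof
    show "spd B" using B by (simp add: spd_def)
  qed (use params grad hess strongly_convex grad_Lipschitz hess_Lipschitz minimizer eta mu0 mu0_le
        init bfgs step standing in auto)
  have H: "R.H = H" by (simp add: R.H_def H_def)
  have \<kappa>: "R.\<kappa> = \<kappa>" by (simp add: R.\<kappa>_def \<kappa>_def)
  have F: "R.F k = f (x k) - fstar" for k by (simp add: R.F_def fstar_def)
  have \<sigma>: "R.\<sigma> = \<sigma>" by (simp add: fun_eq_iff R.\<sigma>_def \<sigma>_def F)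
  have r: "R.r = r" by (simp add: fun_eq_iff R.r_def r_def pnorm_def)
  have \<Delta>: "R.\<Delta> = \<Delta>" by (simp only: R.\<Delta>_def \<Delta>_def)
  have tbar: "R.tbar = tbar" by (simp only: R.tbar_def tbar_def)
  have K_real: "R.K_real = 2 / \<eta>\<^sub>1 * \<kappa>^2 * ln (H^2 * F\<^sub>0 / (0.06 * (1 - 2 * \<eta>\<^sub>1))^2) + 2 * real n * ln \<kappa>"
    by (simp only: R.K_real_def H \<kappa> F F\<^sub>0_def \<Delta> \<Delta>_def n_def)
  have K0: "R.K_real \<le> real K0" if "L\<^sub>2 > 0"
    using that real_nat_ceiling_ge[of R.K_real] unfolding K0_def K_real by auto
  have close: "H * \<sigma> k \<le> \<Delta>" if "K0 \<le> k" for k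
    using R.H_sigma_le[OF K0 that] unfolding H \<sigma> \<Delta> .
  have q: "(\<Sum>i<k. R.q i) \<le> \<Omega>" for k
  proof -
    \<comment> \<open>\<open>S\<close> bounds only the sums with \<open>k \<ge> 1\<close>; one more
      nonnegative term covers the empty sum.\<close>
    have "(\<Sum>i<k. R.q i) \<le> (\<Sum>i<Suc k. R.q i)" using R.q_nonneg[of k] by simp
    also have "\<dots> \<le> psi (hess xstar) (\<mu>\<^sub>0 *\<^sub>R B) + 2 * (H * (\<Sum>i<Suc k. \<sigma> i))"
      using R.sum_q_le[of "Suc k"] unfolding H \<sigma> .
    also have "\<dots> \<le> \<Omega>" using S[of "Suc k"] unfolding \<Omega>_def by simp
    finally show ?thesis .
  qed
  have superlinear: "r (K0 + k) \<le> (1 / 2) ^ k * r K0" if "K1 \<le> k" for k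
  proof -
    have "7 * (1 / omega_star R.tbar + 3.02) * \<Omega> \<le> real K1"
      using real_nat_ceiling_ge unfolding K1_def \<Upsilon>_def tbar .
    also have "\<dots> \<le> real k" using that by simp
    finally show ?thesis
      using R.superlinear_convergence[of K0 \<Omega> k] close q unfolding H \<sigma> r \<Delta>_def by blast
  qed
  have "f (x k) - fstar \<le> \<epsilon>" if "L\<^sub>2 > 0" "real K0 + real K1 + Keps \<le> real k" for k
    using R.gap_le_epsilon[OF that(1) K0[OF that(1)] eps, of K1 k] superlinear that(2)
    unfolding Keps_def H r \<Delta> F by blast
  moreover have "real K0 + real K1 + Keps \<le>
              real (nat \<lceil>2 / \<eta>\<^sub>1 * \<kappa>^2 * ln (H^2 * F\<^sub>0 / (0.06 * (1 - 2 * \<eta>\<^sub>1))^2) + 2 * real n * ln \<kappa>\<rceil>)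
            + real (nat \<lceil>7 * (\<Upsilon> + 3.02) * \<Omega>\<rceil>)
            + real_of_int \<lceil>1/2 * log 2 (0.01 / (H^2 * \<epsilon>))\<rceil>" if "L\<^sub>2 > 0"
    using R.log_term_le[OF that eps] that unfolding Keps_def H \<Delta> K0_def K1_def by simp
  ultimately show ?thesis using close superlinear by blast
qed

end
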